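(* Let $\widehat{W}$ be the affine Weyl group associated to an irreducible crystallographic (finite) root system, with Coxeter generators $\widehat{S}=\{s_0,s_1,\dots,s_n\}$ and length function $\ell$. Let $\mathcal{R}=\bigcup_{\sigma\in\widehat{W}}\sigma\widehat{S}\sigma^{-1}$ be its set of reflections. For any finite subset $A\subset\mathcal{R}$, set $$\widehat{W}^A:=\{\sigma\in\widehat{W}:\ \ell(\sigma r)>\ell(\sigma)\ \text{for all } r\in A\}.$$ Then the Poincaré series $\widehat{W}^A(q)=\sum_{w\in\widehat{W}^A}q^{\ell(w)}$ is a rational function of $q$.
   Context: The affine Weyl group $\widehat{W}=W\ltimes T(Q^\vee)$ is generated by the finite Weyl group $W$ of the root system (with simple reflections $s_1,\dots,s_n$) and the translations by the coroot lattice $Q^\vee$; it is a Coxeter group with generators $s_1,\dots,s_n$ together with $s_0$, the reflection in the affine hyperplane $\{v:(v,\theta)=1\}$ where $\theta$ is the highest root. The length $\ell(w)$ is the minimal length of an expression of $w$ as a product of elements of $\widehat{S}$. *)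

theory Defs
  imports
    "HOL-Analysis.Analysis"
    "HOL-Computational_Algebra.Computational_Algebra"
begin

subsection \<open>Root systems\<close>

definition coroot :: "'a::euclidean_space \<Rightarrow> 'a" where
  "coroot a = (2 / (a \<bullet> a)) *\<^sub>R a"

definition reflection :: "'a::euclidean_space \<Rightarrow> 'a \<Rightarrow> 'a" where
  "reflection a v = v - (v \<bullet> a) *\<^sub>R coroot a"

text \<open>The reflection in the affine hyperplane of all \<open>v\<close> with \<open>v \<bullet> a = k\<close>.\<close>

definition affine_reflection :: "'a::euclidean_space \<Rightarrow> real \<Rightarrow> 'a \<Rightarrow> 'a" where
  "affine_reflection a k v = v - (v \<bullet> a - k) *\<^sub>R coroot a"

text \<open>Finite, reduced, crystallographic root systems spanning the ambient Euclidean space.\<close>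

definition root_system :: "'a::euclidean_space set \<Rightarrow> bool" where
  "root_system \<Phi> \<longleftrightarrow>
     finite \<Phi> \<and> 0 \<notin> \<Phi> \<and> span \<Phi> = UNIV \<and>
     (\<forall>a\<in>\<Phi>. reflection a ` \<Phi> = \<Phi>) \<and>
     (\<forall>a\<in>\<Phi>. \<forall>c::real. c *\<^sub>R a \<in> \<Phi> \<longrightarrow> c = 1 \<or> c = -1) \<and>
     (\<forall>a\<in>\<Phi>. \<forall>b\<in>\<Phi>. b \<bullet> coroot a \<in> \<int>)"

definition irreducible_root_system :: "'a::euclidean_space set \<Rightarrow> bool" where
  "irreducible_root_system \<Phi> \<longleftrightarrow>
     root_system \<Phi> \<and> \<Phi> \<noteq> {} \<and>
     \<not> (\<exists>\<Phi>1 \<Phi>2. \<Phi>1 \<noteq> {} \<and> \<Phi>2 \<noteq> {} \<and> \<Phi>1 \<union> \<Phi>2 = \<Phi> \<and>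
          (\<forall>a\<in>\<Phi>1. \<forall>b\<in>\<Phi>2. a \<bullet> b = 0))"

definition nonneg_comb :: "'a::euclidean_space set \<Rightarrow> 'a \<Rightarrow> bool" where
  "nonneg_comb \<Delta> v \<longleftrightarrow> (\<exists>c::'a \<Rightarrow> nat. v = (\<Sum>a\<in>\<Delta>. real (c a) *\<^sub>R a))"

definition simple_system :: "'a::euclidean_space set \<Rightarrow> 'a set \<Rightarrow> bool" where
  "simple_system \<Phi> \<Delta> \<longleftrightarrow>
     \<Delta> \<subseteq> \<Phi> \<and> independent \<Delta> \<and> (\<forall>b\<in>\<Phi>. nonneg_comb \<Delta> b \<or> nonneg_comb \<Delta> (- b))"

definition highest_root :: "'a::euclidean_space set \<Rightarrow> 'a set \<Rightarrow> 'a \<Rightarrow> bool" where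
  "highest_root \<Phi> \<Delta> \<theta> \<longleftrightarrow> \<theta> \<in> \<Phi> \<and> (\<forall>b\<in>\<Phi>. nonneg_comb \<Delta> (\<theta> - b))"

subsection \<open>Affine Weyl groups\<close>

text \<open>Groups of transformations under composition; \<open>transformation_group hull X\<close> is then
  the group generated by a set \<open>X\<close> of bijections.\<close>

definition transformation_group :: "('a \<Rightarrow> 'a) set \<Rightarrow> bool" where
  "transformation_group G \<longleftrightarrow>
     id \<in> G \<and> (\<forall>f\<in>G. bij f) \<and> (\<forall>f\<in>G. \<forall>g\<in>G. f \<circ> g \<in> G) \<and> (\<forall>f\<in>G. inv f \<in> G)"

definition weyl_group :: "'a::euclidean_space set \<Rightarrow> ('a \<Rightarrow> 'a) set" where
  "weyl_group \<Phi> = transformation_group hull (reflection ` \<Phi>)"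

definition coroot_lattice :: "'a::euclidean_space set \<Rightarrow> 'a set" where
  "coroot_lattice \<Phi> = group_closure (coroot ` \<Phi>)"

definition affine_weyl_group :: "'a::euclidean_space set \<Rightarrow> ('a \<Rightarrow> 'a) set" where
  "affine_weyl_group \<Phi> =
     transformation_group hull (weyl_group \<Phi> \<union> (\<lambda>x. (+) x) ` coroot_lattice \<Phi>)"

definition affine_generators :: "'a::euclidean_space set \<Rightarrow> 'a \<Rightarrow> ('a \<Rightarrow> 'a) set" where
  "affine_generators \<Delta> \<theta> = insert (affine_reflection \<theta> 1) (reflection ` \<Delta>)"

definition affine_reflections ::
    "'a::euclidean_space set \<Rightarrow> 'a set \<Rightarrow> 'a \<Rightarrow> ('a \<Rightarrow> 'a) set" where
  "affine_reflections \<Phi> \<Delta> \<theta> =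
     (\<Union>\<sigma>\<in>affine_weyl_group \<Phi>. (\<lambda>s. \<sigma> \<circ> s \<circ> inv \<sigma>) ` affine_generators \<Delta> \<theta>)"

text \<open>Minimal length of a word in \<open>S\<close> with product \<open>w\<close>; only meaningful if such a word
  exists.\<close>

definition word_length :: "('a \<Rightarrow> 'a) set \<Rightarrow> ('a \<Rightarrow> 'a) \<Rightarrow> nat" where
  "word_length S w = (LEAST n. \<exists>ss. set ss \<subseteq> S \<and> foldr (\<circ>) ss id = w \<and> length ss = n)"

definition affine_length :: "'a::euclidean_space set \<Rightarrow> 'a \<Rightarrow> ('a \<Rightarrow> 'a) \<Rightarrow> nat" where
  "affine_length \<Delta> \<theta> = word_length (affine_generators \<Delta> \<theta>)"

definition affine_weyl_avoiding ::
    "'a::euclidean_space set \<Rightarrow> 'a set \<Rightarrow> 'a \<Rightarrow> ('a \<Rightarrow> 'a) set \<Rightarrow> ('a \<Rightarrow> 'a) set" where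
  "affine_weyl_avoiding \<Phi> \<Delta> \<theta> A =
     {\<sigma> \<in> affine_weyl_group \<Phi>. \<forall>r\<in>A. affine_length \<Delta> \<theta> (\<sigma> \<circ> r) > affine_length \<Delta> \<theta> \<sigma>}"

subsection \<open>Generating functions\<close>

text \<open>The formal power series \<open>\<Sum>w\<in>X. q ^ len w\<close>, collected by powers of \<open>q\<close>. For the
  length function of a finitely generated group every coefficient counts a finite set.\<close>

definition length_series :: "('b \<Rightarrow> nat) \<Rightarrow> 'b set \<Rightarrow> rat fps" where
  "length_series len X = Abs_fps (\<lambda>n. of_nat (card {w \<in> X. len w = n}))"

definition rational_fps :: "'k::field fps \<Rightarrow> bool" where
  "rational_fps F \<longleftrightarrow> (\<exists>p d :: 'k poly. d \<noteq> 0 \<and> fps_of_poly d * F = fps_of_poly p)"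

end

theory Submission
  imports Defs
begin

text \<open>Fix a point \<open>p\<close> in the fundamental alcove. The length of \<open>w\<close> is the number of affine
  hyperplanes separating \<open>p\<close> from \<open>w p\<close>, and \<open>w r\<close> is longer than \<open>w\<close> iff \<open>w\<^sup>-\<^sup>1 p\<close> lies on the same
  side of the hyperplane of \<open>r\<close> as \<open>p\<close>. Replacing \<open>w\<close> by its inverse, the series counts by length
  the \<open>w\<close> for which \<open>w p\<close> lies in an intersection of finitely many half-spaces. Write
  \<open>w p = x + g p\<close> with \<open>g\<close> the linear part. For each of the finitely many \<open>g\<close> the translations \<open>x\<close>
  form a coset of a lattice, and once the signs of the coordinates of \<open>x\<close> on the roots (suitably
  shifted) are fixed, the length is an affine function of \<open>x\<close> and the half-spaces become affine
  inequalities.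

  So it remains to count lattice points of a polyhedron \<open>X\<close> by an affine function \<open>f\<close> with finite
  fibres. If \<open>X\<close> is infinite, Dickson's lemma gives \<open>u\<close> and \<open>v\<close> in \<open>X\<close> such that all constraints
  weakly increase and \<open>f\<close> strictly increases from \<open>u\<close> to \<open>v\<close>. Translation by \<open>v - u\<close> maps \<open>X\<close> into
  itself and multiplies the series by a power of \<open>q\<close>; the complement of the image consists of
  finitely many slices on which some constraint is constant, so induction on the number of
  constraints applies.\<close>

unbundle no vec_syntax

section \<open>Rational series\<close>

lemma rational_fps_of_poly: "rational_fps (fps_of_poly p)"
  unfolding rational_fps_def by (rule exI[of _ p], rule exI[of _ 1]) simp

lemma rational_fps_0: "rational_fps 0"
  using rational_fps_of_poly[of 0] by simp

lemma rational_fps_add: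
  assumes "rational_fps F" "rational_fps G"
  shows "rational_fps (F + G)"
proof -
  obtain p d p' d' where *: "d \<noteq> 0" "fps_of_poly d * F = fps_of_poly p"
      "d' \<noteq> 0" "fps_of_poly d' * G = fps_of_poly p'"
    using assms unfolding rational_fps_def by blast
  have "fps_of_poly (d * d') * (F + G) =
      fps_of_poly d' * (fps_of_poly d * F) + fps_of_poly d * (fps_of_poly d' * G)"
    by (simp add: fps_of_poly_mult algebra_simps)
  also have "\<dots> = fps_of_poly (d' * p + d * p')"
    by (simp add: * fps_of_poly_mult fps_of_poly_add)
  finally show ?thesis
    unfolding rational_fps_def using * by (metis mult_eq_0_iff)
qed

lemma rational_fps_sum:
  assumes "\<And>i. i \<in> I \<Longrightarrow> rational_fps (F i)"
  shows "rational_fps (\<Sum>i\<in>I. F i)"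
  using assms by (induction I rule: infinite_finite_induct)
    (auto intro: rational_fps_add rational_fps_0)

lemma rational_fps_cancel:
  assumes "d \<noteq> 0" "rational_fps (fps_of_poly d * F)"
  shows "rational_fps F"
proof -
  obtain p d' where "d' \<noteq> 0" "fps_of_poly d' * (fps_of_poly d * F) = fps_of_poly p"
    using assms(2) unfolding rational_fps_def by blast
  then have "fps_of_poly (d' * d) * F = fps_of_poly p" "d' * d \<noteq> 0"
    using assms(1) by (simp_all add: fps_of_poly_mult mult.assoc)
  then show ?thesis
    unfolding rational_fps_def by blast
qed

text \<open>\<open>card\<close> is 0 on infinite sets, so finiteness of the levels is what makes the
  coefficients add up.\<close>

lemma length_series_UN:
  assumes "finite I" "\<And>n. finite {x \<in> (\<Union>i\<in>I. X i). len x = n}"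
    and "\<And>i j. i \<in> I \<Longrightarrow> j \<in> I \<Longrightarrow> i \<noteq> j \<Longrightarrow> X i \<inter> X j = {}"
  shows "length_series len (\<Union>i\<in>I. X i) = (\<Sum>i\<in>I. length_series len (X i))"
proof (rule fps_ext)
  fix n
  have "{x \<in> (\<Union>i\<in>I. X i). len x = n} = (\<Union>i\<in>I. {x \<in> X i. len x = n})"
    by auto
  moreover have "card (\<Union>i\<in>I. {x \<in> X i. len x = n}) = (\<Sum>i\<in>I. card {x \<in> X i. len x = n})"
  proof (rule card_UN_disjoint)
    show "\<forall>i\<in>I. finite {x \<in> X i. len x = n}"
      by (intro ballI finite_subset[OF _ assms(2)[of n]]) auto
  qed (use assms in blast)+
  ultimately show "length_series len (\<Union>i\<in>I. X i) $ n = (\<Sum>i\<in>I. length_series len (X i)) $ n"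
    by (simp add: length_series_def fps_sum_nth)
qed

lemma length_series_Un:
  assumes "\<And>n. finite {x \<in> X \<union> Y. len x = n}" "X \<inter> Y = {}"
  shows "length_series len (X \<union> Y) = length_series len X + length_series len Y"
proof -
  have "X \<union> Y = (\<Union>i\<in>UNIV. if i then X else Y)"
    by (auto split: if_splits)
  then show ?thesis
    using length_series_UN[of UNIV "\<lambda>i. if i then X else Y" len] assms
    by (simp add: UNIV_bool Int_commute add.commute)
qed

lemma length_series_bij_betw:
  assumes "bij_betw h X Y" "\<And>x. x \<in> X \<Longrightarrow> len' (h x) = len x"
  shows "length_series len X = length_series len' Y"
proof (rule fps_ext)
  fix n
  have "bij_betw h {x \<in> X. len x = n} {y \<in> Y. len' y = n}"
    using assms unfolding bij_betw_def inj_on_def by force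
  then show "length_series len X $ n = length_series len' Y $ n"
    by (simp add: length_series_def bij_betw_same_card)
qed

lemma length_series_shift:
  assumes "bij_betw h X Y" "\<And>x. x \<in> X \<Longrightarrow> len (h x) = len x + m"
  shows "length_series len Y = fps_X ^ m * length_series len X"
proof (rule fps_ext)
  fix n
  have Y: "Y = h ` X" and inj: "inj_on h X"
    using assms(1) by (auto simp: bij_betw_def)
  have "{y \<in> Y. len y = n} = (if n < m then {} else h ` {x \<in> X. len x = n - m})"
    unfolding Y using assms(2) by auto
  moreover have "card (h ` {x \<in> X. len x = n - m}) = card {x \<in> X. len x = n - m}"
    by (rule card_image) (use inj in \<open>auto simp: inj_on_def\<close>)
  ultimately show "length_series len Y $ n = (fps_X ^ m * length_series len X) $ n"
    by (simp add: length_series_def fps_X_power_mult_nth)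
qed

lemma rational_length_series_finite:
  assumes "finite X"
  shows "rational_fps (length_series len X)"
proof -
  have "length_series len X = fps_of_poly (Abs_poly (\<lambda>n. of_nat (card {x \<in> X. len x = n})))"
  proof (rule fps_ext)
    fix n
    have "card {x \<in> X. len x = i} = 0" if "i > Max (len ` X)" for i
      using that assms by (metis (mono_tags, lifting) Max_ge card.empty empty_Collect_eq
          finite_imageI imageI not_le)
    then have "coeff (Abs_poly (\<lambda>n. of_nat (card {x \<in> X. len x = n}))) i =
        (of_nat (card {x \<in> X. len x = i}) :: rat)" for i
      by (subst coeff_Abs_poly[of "Max (len ` X)"]) auto
    then show "length_series len X $ n =
        fps_of_poly (Abs_poly (\<lambda>n. of_nat (card {x \<in> X. len x = n}))) $ n"
      by (simp add: length_series_def)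
  qed
  then show ?thesis
    by (simp add: rational_fps_of_poly)
qed

section \<open>Lattice points of polyhedra\<close>

text \<open>A monotone subsequence always exists; if it is decreasing, it is constant from the point
  where it attains its minimum, and that tail will do.\<close>

lemma nat_sequence_incseq_subseq:
  fixes g :: "nat \<Rightarrow> nat"
  obtains r where "strict_mono r" "incseq (g \<circ> r)"
proof -
  obtain r :: "nat \<Rightarrow> nat" where r: "strict_mono r" "monoseq (\<lambda>n. g (r n))"
    using seq_monosub[of g] by blast
  show thesis
  proof (cases "incseq (\<lambda>n. g (r n))")
    case True
    then show ?thesis
      using that[OF r(1)] by (simp add: o_def)
  next
    case False
    then have dec: "decseq (\<lambda>n. g (r n))"
      using r(2) monoseq_iff by blast
    obtain m where m: "\<And>n. g (r m) \<le> g (r n)"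
      using ex_has_least_nat[of "\<lambda>_. True" 0 "\<lambda>n. g (r n)"] by auto
    have "g (r (n + m)) = g (r m)" for n
      using m[of "n + m"] decseqD[OF dec, of m "n + m"] by simp
    moreover have "strict_mono (\<lambda>n. r (n + m))"
      using r(1) by (simp add: strict_mono_def)
    ultimately show ?thesis
      using that[of "\<lambda>n. r (n + m)"] by (simp add: o_def incseq_def)
  qed
qed

text \<open>Dickson's lemma in sequential form: the subsequence is refined once for each coordinate,
  and monotonicity already gained survives refinement.\<close>

lemma dickson_subseq:
  fixes g :: "'i \<Rightarrow> nat \<Rightarrow> nat"
  assumes "finite I"
  shows "\<exists>r. strict_mono r \<and> (\<forall>i\<in>I. incseq (g i \<circ> r))"
  using assms
proof (induction I)
  case empty
  show ?case
    using strict_mono_id by blast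
next
  case (insert i I)
  then obtain r where r: "strict_mono r" "\<forall>i\<in>I. incseq (g i \<circ> r)"
    by blast
  obtain r' where r': "strict_mono r'" "incseq ((g i \<circ> r) \<circ> r')"
    by (rule nat_sequence_incseq_subseq)
  have "incseq (g j \<circ> (r \<circ> r'))" if "j \<in> I" for j
    using r(2) that r'(1) by (auto simp: incseq_def strict_mono_less_eq)
  then show ?case
    using r(1) r' unfolding o_assoc
    by (intro exI[of _ "r \<circ> r'"] conjI ballI strict_mono_o)
      (auto simp: o_def)
qed

text \<open>Affineness is stated through \<open>x + y - z\<close> because the domain will be a coset
  of a lattice and need not contain 0.\<close>

definition affine_on :: "'a::ab_group_add set \<Rightarrow> ('a \<Rightarrow> int) \<Rightarrow> bool" where
  "affine_on L f \<longleftrightarrow> (\<forall>x\<in>L. \<forall>y\<in>L. \<forall>z\<in>L. f (x + y - z) = f x + f y - f z)"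

definition polyhedron_points ::
    "'a::ab_group_add set \<Rightarrow> 'i set \<Rightarrow> ('i \<Rightarrow> 'a \<Rightarrow> int) \<Rightarrow> ('i \<Rightarrow> int) \<Rightarrow> 'a set" where
  "polyhedron_points L I c b = {x \<in> L. \<forall>i\<in>I. b i \<le> c i x}"

text \<open>\<open>L\<close> and \<open>b\<close> vary in the induction because a slice on which one
  constraint is constant is again of this kind: \<open>L\<close> shrinks to the points with that
  value, and the constraint leaves \<open>I\<close>.\<close>

lemma rational_length_series_polyhedron:
  fixes L :: "'a::ab_group_add set" and c :: "'i \<Rightarrow> 'a \<Rightarrow> int" and f :: "'a \<Rightarrow> int"
  assumes "finite I"
    and "\<And>x y z. x \<in> L \<Longrightarrow> y \<in> L \<Longrightarrow> z \<in> L \<Longrightarrow> x + y - z \<in> L"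
    and "\<And>i. i \<in> I \<Longrightarrow> affine_on L (c i)" and "affine_on L f"
    and "\<And>x. x \<in> polyhedron_points L I c b \<Longrightarrow> 0 \<le> f x"
    and "\<And>n. finite {x \<in> polyhedron_points L I c b. nat (f x) = n}"
  shows "rational_fps (length_series (\<lambda>x. nat (f x)) (polyhedron_points L I c b))"
  using assms
proof (induction "card I" arbitrary: I L b rule: less_induct)
  case (less I L b)
  note IH = less.hyps and L = less.prems(2) and aff = less.prems(3,4)
    and nonneg = less.prems(5) and fin = less.prems(6) and [simp] = \<open>finite I\<close>
  let ?X = "polyhedron_points L I c" and ?s = "length_series (\<lambda>x. nat (f x))"
  show ?case
  proof (cases "finite (?X b)")
    case True
    then show ?thesis
      by (rule rational_length_series_finite)
  next
    case infinite: False
    \<comment> \<open>Raising the bounds to \<open>b'\<close> removes finitely many slices, with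
      total series \<open>F\<close>; the inner induction is on the total raise.\<close>
    have diff: "\<exists>F. rational_fps F \<and> ?s (?X b) = ?s (?X b') + F" if "\<forall>i\<in>I. b i \<le> b' i" for b'
      using that
    proof (induction "\<Sum>i\<in>I. nat (b' i - b i)" arbitrary: b' rule: less_induct)
      case (less b')
      show ?case
      proof (cases "\<forall>i\<in>I. b' i = b i")
        case True
        then have "?X b' = ?X b"
          by (auto simp: polyhedron_points_def)
        then show ?thesis
          using rational_fps_0 by (intro exI[of _ 0]) auto
      next
        case False
        then obtain i where i: "i \<in> I" "b i < b' i"
          using less.prems by force
        \<comment> \<open>One unit of the raise at \<open>i\<close> is taken back. By integrality,
          the points this regains are those of the \<open>b''\<close> polyhedron with
          \<open>c i x = b'' i\<close>.\<close>
        define b'' where "b'' = b'(i := b' i - 1)"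
        define L' where "L' = {x \<in> L. c i x = b'' i}"
        have b'': "\<forall>i\<in>I. b i \<le> b'' i"
          using less.prems i by (auto simp: b''_def)
        have sub: "?X b'' \<subseteq> ?X b"
          using b'' by (force simp: polyhedron_points_def)
        have "(\<Sum>i\<in>I. nat (b'' i - b i)) < (\<Sum>i\<in>I. nat (b' i - b i))"
          by (rule sum_strict_mono_ex1) (use i in \<open>auto simp: b''_def intro!: bexI[of _ i]\<close>)
        then obtain F where F: "rational_fps F" "?s (?X b) = ?s (?X b'') + F"
          using less.hyps b'' by blast
        let ?Y = "polyhedron_points L' (I - {i}) c b''"
        have "x \<in> ?X b'' \<longleftrightarrow> x \<in> ?X b' \<or> x \<in> ?Y" for x
        proof -
          have "(\<forall>j\<in>I. h j \<le> c j x) \<longleftrightarrow> h i \<le> c i x \<and> (\<forall>j\<in>I - {i}. h j \<le> c j x)" for h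
            using i by blast
          moreover have "(\<forall>j\<in>I - {i}. b'' j \<le> c j x) \<longleftrightarrow> (\<forall>j\<in>I - {i}. b' j \<le> c j x)"
            by (simp add: b''_def)
          moreover have "b'' i \<le> c i x \<longleftrightarrow> b' i \<le> c i x \<or> c i x = b'' i"
            by (auto simp: b''_def)
          ultimately show ?thesis
            by (auto simp: polyhedron_points_def L'_def)
        qed
        moreover have "x \<notin> ?Y" if "x \<in> ?X b'" for x
          using that i by (force simp: polyhedron_points_def L'_def b''_def)
        ultimately have eq: "?X b'' = ?X b' \<union> ?Y" "?X b' \<inter> ?Y = {}"
          by blast+
        have fin'': "finite {x \<in> ?X b''. nat (f x) = n}" for n
          by (rule finite_subset[OF _ fin[of n]]) (use sub in auto)
        have "rational_fps (?s ?Y)"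
        proof (rule IH)
          show "card (I - {i}) < card I"
            using i by (intro card_Diff1_less) auto
          show "x + y - z \<in> L'" if "x \<in> L'" "y \<in> L'" "z \<in> L'" for x y z
            using that L aff(1)[OF i(1)] by (auto simp: L'_def affine_on_def)
          show "affine_on L' (c j)" if "j \<in> I - {i}" for j
            using that aff(1)[of j] by (auto simp: L'_def affine_on_def)
          show "affine_on L' f"
            using aff(2) by (auto simp: L'_def affine_on_def)
          show "0 \<le> f x" if "x \<in> ?Y" for x
            using that nonneg sub eq by blast
          show "finite {x \<in> ?Y. nat (f x) = n}" for n
            by (rule finite_subset[OF _ fin''[of n]]) (use eq in auto)
        qed simp
        then show ?thesis
          using F length_series_Un[of "?X b'" ?Y "\<lambda>x. nat (f x)"] eq fin''
          by (intro exI[of _ "F + ?s ?Y"]) (auto intro: rational_fps_add)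
      qed
    qed
    \<comment> \<open>Finite fibres over an infinite set force infinitely many values, so some
      sequence of points has strictly increasing \<open>f\<close>.\<close>
    have "infinite ((\<lambda>x. nat (f x)) ` ?X b)"
    proof
      assume *: "finite ((\<lambda>x. nat (f x)) ` ?X b)"
      have "?X b = (\<Union>n\<in>(\<lambda>x. nat (f x)) ` ?X b. {x \<in> ?X b. nat (f x) = n})"
        by auto
      also have "finite \<dots>"
        using * fin by (intro finite_UN_I) auto
      finally show False
        using infinite by simp
    qed
    then obtain e :: "nat \<Rightarrow> nat" where e: "strict_mono e" "range e \<subseteq> (\<lambda>x. nat (f x)) ` ?X b"
      by (metis infinite_enumerate range_enumerate strict_mono_enumerate subset_refl)
    then have "\<forall>n. \<exists>x\<in>?X b. nat (f x) = e n"
      by (metis (no_types, lifting) imageE rangeI subset_iff)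
    then obtain u where u: "\<And>n. u n \<in> ?X b" "\<And>n. nat (f (u n)) = e n"
      by metis
    \<comment> \<open>All constraints become weakly increasing at once; \<open>nat\<close> loses
      nothing because \<open>b i \<le> c i (u n)\<close>.\<close>
    obtain r where r: "strict_mono r" "\<forall>i\<in>I. incseq ((\<lambda>n. nat (c i (u n) - b i)) \<circ> r)"
      using dickson_subseq[of I "\<lambda>i n. nat (c i (u n) - b i)"] by auto
    define x y where "x = u (r 0)" and "y = u (r 1)"
    have xy: "x \<in> ?X b" "y \<in> ?X b" "x \<in> L" "y \<in> L"
      using u(1) by (auto simp: x_def y_def polyhedron_points_def)
    have "e (r 0) < e (r 1)"
      using e(1) r(1) by (simp add: strict_mono_less)
    then have fxy: "f x < f y"
      using u(2)[of "r 0"] u(2)[of "r 1"] by (simp add: x_def y_def)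
    have cxy: "c i x \<le> c i y" if "i \<in> I" for i
      using that xy(1,2) incseqD[OF bspec[OF r(2) that], of 0 1]
      by (auto simp: x_def y_def polyhedron_points_def)
    \<comment> \<open>Translation by \<open>y - x\<close> raises \<open>c i\<close> by exactly
      \<open>c i y - c i x\<close>, so it maps the polyhedron onto the one with bounds
      \<open>b'\<close>.\<close>
    define b' where "b' = (\<lambda>i. b i + (c i y - c i x))"
    define m where "m = nat (f y - f x)"
    have "?s (?X b') = fps_X ^ m * ?s (?X b)"
    proof (rule length_series_shift)
      have c_shift: "c i (z + y - x) = c i z + c i y - c i x" "c i (z + x - y) = c i z + c i x - c i y"
        if "i \<in> I" "z \<in> L" for i z
        using that aff(1) xy unfolding affine_on_def by blast+
      show "bij_betw (\<lambda>z. z + y - x) (?X b) (?X b')"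
        by (rule bij_betw_byWitness[where f' = "\<lambda>z. z + x - y"])
          (use L xy in \<open>force simp: polyhedron_points_def b'_def c_shift\<close>)+
      show "nat (f (z + y - x)) = nat (f z) + m" if "z \<in> ?X b" for z
      proof -
        have "f (z + y - x) = f z + f y - f x"
          using aff(2) xy that unfolding affine_on_def polyhedron_points_def by blast
        then show ?thesis
          using nonneg[OF that] fxy by (simp add: m_def)
      qed
    qed
    moreover obtain F where F: "rational_fps F" "?s (?X b) = ?s (?X b') + F"
      using diff[of b'] cxy by (auto simp: b'_def)
    \<comment> \<open>The series \<open>s\<close> of the polyhedron satisfies
      \<open>s = q ^ m * s + F\<close>, which is solved for \<open>s\<close> after division by
      \<open>1 - q ^ m\<close>.\<close>
    ultimately have "fps_of_poly (1 - monom 1 m) * ?s (?X b) = F"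
      by (simp add: fps_of_poly_diff fps_of_poly_monom' algebra_simps)
    moreover have "1 - monom 1 m \<noteq> (0 :: rat poly)"
    proof
      assume "1 - monom 1 m = (0 :: rat poly)"
      then have "coeff (1 - monom 1 m :: rat poly) m = 0"
        by simp
      moreover have "m \<noteq> 0"
        using fxy by (simp add: m_def)
      ultimately show False
        by simp
    qed
    ultimately show ?thesis
      using rational_fps_cancel F(1) by metis
  qed
qed

section \<open>Reflection arrangements\<close>

primrec word_prod :: "('a \<Rightarrow> 'a) list \<Rightarrow> 'a \<Rightarrow> 'a" where
  "word_prod [] = id"
| "word_prod (s # ss) = s \<circ> word_prod ss"

lemma foldr_comp_eq_word_prod: "foldr (\<circ>) ss id = word_prod ss"
  by (induction ss) auto

lemma word_length_eq:
  "word_length S w = (LEAST n. \<exists>ss. set ss \<subseteq> S \<and> word_prod ss = w \<and> length ss = n)"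
  by (simp add: word_length_def foldr_comp_eq_word_prod)

lemma word_prod_append: "word_prod (ss @ ts) = word_prod ss \<circ> word_prod ts"
  by (induction ss) (auto simp: o_assoc)

lemma word_length_le: "set ss \<subseteq> S \<Longrightarrow> word_length S (word_prod ss) \<le> length ss"
  unfolding word_length_eq by (rule Least_le) blast

lemma reduced_word_exists:
  assumes "set ss \<subseteq> S"
  obtains ts where "set ts \<subseteq> S" "word_prod ts = word_prod ss"
    "length ts = word_length S (word_prod ss)"
proof -
  have "\<exists>ts. set ts \<subseteq> S \<and> word_prod ts = word_prod ss \<and> length ts = word_length S (word_prod ss)"
    unfolding word_length_eq by (rule LeastI) (use assms in blast)
  then show thesis
    using that by blast
qed

text \<open>The roots are real functions whose zero sets are the reflecting hyperplanes; \<open>p\<close> lies in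
  the fundamental chamber, so that a root \<open>a\<close> is positive iff \<open>0 < a p\<close>.\<close>

locale reflection_arrangement =
  fixes R :: "('a \<Rightarrow> real) set" and rf :: "('a \<Rightarrow> real) \<Rightarrow> 'a \<Rightarrow> 'a"
    and D :: "('a \<Rightarrow> real) set" and p :: 'a
  assumes root_rf: "a \<in> R \<Longrightarrow> b \<in> R \<Longrightarrow> a \<circ> rf b \<in> R"
    and rf_rf: "a \<in> R \<Longrightarrow> rf a \<circ> rf a = id"
    and root_rf_self: "a \<in> R \<Longrightarrow> a (rf a v) = - a v"
    and rf_conj: "a \<in> R \<Longrightarrow> b \<in> R \<Longrightarrow> rf (a \<circ> rf b) = rf b \<circ> rf a \<circ> rf b"
    and root_nonzero: "a \<in> R \<Longrightarrow> a p \<noteq> 0"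
    and D_subset: "D \<subseteq> R"
    and D_pos: "s \<in> D \<Longrightarrow> 0 < s p"
    and rf_D_pos: "s \<in> D \<Longrightarrow> a \<in> R \<Longrightarrow> 0 < a p \<Longrightarrow> a \<noteq> s \<Longrightarrow> 0 < a (rf s p)"
    and descent: "a \<in> R \<Longrightarrow> 0 < a p \<Longrightarrow> a \<notin> D \<Longrightarrow> \<exists>s\<in>D. a (rf s p) < a p"
    and finite_below: "finite {b \<in> R. 0 < b p \<and> b p < M}"
begin

section \<open>The generated group contains all reflections\<close>

definition G :: "('a \<Rightarrow> 'a) set" where
  "G = {word_prod ss |ss. set ss \<subseteq> rf ` D}"

lemma word_in_G: "set ss \<subseteq> rf ` D \<Longrightarrow> word_prod ss \<in> G"
  unfolding G_def by blast

lemma id_in_G: "id \<in> G"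
  using word_in_G[of "[]"] by simp

lemma comp_in_G: "v \<in> G \<Longrightarrow> w \<in> G \<Longrightarrow> v \<circ> w \<in> G"
  unfolding G_def using word_prod_append[symmetric]
  by (smt (verit, best) Un_subset_iff mem_Collect_eq set_append)

lemma rf_D_in_G: "s \<in> D \<Longrightarrow> rf s \<in> G"
  using word_in_G[of "[rf s]"] by simp

text \<open>Induction on the number of positive roots with smaller value at \<open>p\<close>. A
  simple \<open>s\<close> that lowers this value turns \<open>a\<close> into
  \<open>a \<circ> rf s\<close>, still positive because \<open>a \<noteq> s\<close>, and
  \<open>rf a\<close> is the conjugate by \<open>rf s\<close> of its reflection.\<close>

lemma rf_in_G:
  assumes "a \<in> R" "0 < a p"
  shows "rf a \<in> G"
  using assms
proof (induction "card {b \<in> R. 0 < b p \<and> b p < a p}" arbitrary: a rule: less_induct)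
  case less
  show ?case
  proof (cases "a \<in> D")
    case False
    then obtain s where s: "s \<in> D" "a (rf s p) < a p"
      using descent less.prems by blast
    define b where "b = a \<circ> rf s"
    have sR: "s \<in> R"
      using s D_subset by blast
    have b: "b \<in> R" "0 < b p" "b p < a p"
      using s less.prems root_rf sR rf_D_pos[of s a] False by (auto simp: b_def)
    have "{c \<in> R. 0 < c p \<and> c p < b p} \<subset> {c \<in> R. 0 < c p \<and> c p < a p}"
      using b by auto
    then have "rf b \<in> G"
      using less.hyps[of b] b(1,2) psubset_card_mono[OF finite_below] by blast
    moreover have "rf s \<circ> (rf b \<circ> rf s) = (rf s \<circ> rf s) \<circ> rf a \<circ> (rf s \<circ> rf s)"
      unfolding b_def rf_conj[OF less.prems(1) sR] by (simp only: o_assoc)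
    then have "rf a = rf s \<circ> (rf b \<circ> rf s)"
      using rf_rf[OF sR] by simp
    ultimately show ?thesis
      using rf_D_in_G[OF s(1)] comp_in_G by metis
  qed (simp add: rf_D_in_G)
qed

section \<open>Action on roots, inversions and length\<close>

lemma root_comp_word: "set ss \<subseteq> rf ` D \<Longrightarrow> a \<in> R \<Longrightarrow> a \<circ> word_prod ss \<in> R"
proof (induction ss arbitrary: a)
  case (Cons s ss)
  then have "(a \<circ> s) \<circ> word_prod ss \<in> R"
    using root_rf D_subset by fastforce
  then show ?case
    by (simp only: word_prod.simps o_assoc)
qed simp

lemma root_comp_G: "w \<in> G \<Longrightarrow> a \<in> R \<Longrightarrow> a \<circ> w \<in> R"
  using root_comp_word by (auto simp: G_def)

text \<open>These roots stand for the hyperplanes separating \<open>p\<close> from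
  \<open>w p\<close>; in the affine case each hyperplane has just one root that is positive at
  \<open>p\<close>.\<close>

definition inversions :: "('a \<Rightarrow> 'a) \<Rightarrow> ('a \<Rightarrow> real) set" where
  "inversions w = {a \<in> R. 0 < a p \<and> a (w p) < 0}"

lemma inversions_id: "inversions id = {}"
  by (auto simp: inversions_def)

text \<open>\<open>rf s\<close> permutes the positive roots other than \<open>s\<close>, so
  composition with it carries the inversions other than \<open>s\<close> along, while
  \<open>s\<close> itself changes sign between \<open>w p\<close> and
  \<open>rf s (w p)\<close>.\<close>

lemma inversions_rf_comp:
  assumes "s \<in> D" "w \<in> G"
  shows "inversions (rf s \<circ> w) =
    (\<lambda>a. a \<circ> rf s) ` (inversions w - {s}) \<union> (if 0 < s (w p) then {s} else {})" (is "_ = ?A \<union> ?B")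
proof -
  have sR: "s \<in> R"
    using assms D_subset by blast
  have s2: "rf s (rf s v) = v" for v
    using rf_rf[OF sR] by (metis comp_apply id_apply)
  have comp2: "(a \<circ> rf s) \<circ> rf s = a" for a :: "'a \<Rightarrow> real"
    by (simp add: fun_eq_iff s2)
  have sub: "a \<in> ?A \<union> ?B" if a: "a \<in> inversions (rf s \<circ> w)" for a
  proof (cases "a = s")
    case True
    then show ?thesis
      using a root_rf_self[OF sR] by (auto simp: inversions_def)
  next
    case False
    have "a \<circ> rf s \<in> inversions w"
      using a root_rf[OF _ sR] rf_D_pos[OF assms(1)] False by (auto simp: inversions_def)
    moreover have "a \<circ> rf s \<noteq> s"
    proof
      assume "a \<circ> rf s = s"
      then have "a p = s (rf s p)"
        using s2 by (metis comp_apply)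
      then show False
        using a root_rf_self[OF sR] D_pos[OF assms(1)] by (auto simp: inversions_def)
    qed
    ultimately have "a \<circ> rf s \<circ> rf s \<in> ?A"
      by blast
    then show ?thesis
      unfolding comp2 by blast
  qed
  have "a \<circ> rf s \<in> inversions (rf s \<circ> w)" if "a \<in> inversions w - {s}" for a
    using that root_rf[OF _ sR] rf_D_pos[OF assms(1)] s2 by (auto simp: inversions_def)
  moreover have "s \<in> inversions (rf s \<circ> w)" if "0 < s (w p)"
    using that sR D_pos[OF assms(1)] root_rf_self[OF sR] by (auto simp: inversions_def)
  ultimately have "?A \<subseteq> inversions (rf s \<circ> w)" "?B \<subseteq> inversions (rf s \<circ> w)"
    by (auto simp del: o_apply)
  then show ?thesis
    using sub by (intro equalityI subsetI Un_least) blast+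
qed

lemma finite_inversions_word: "set ss \<subseteq> rf ` D \<Longrightarrow> finite (inversions (word_prod ss))"
proof (induction ss)
  case (Cons s ss)
  then obtain t where t: "s = rf t" "t \<in> D"
    by auto
  have "finite (inversions (rf t \<circ> word_prod ss))"
    using Cons inversions_rf_comp[OF t(2) word_in_G[of ss]] by simp
  then show ?case
    by (simp only: word_prod.simps t(1))
qed (simp add: inversions_id)

lemma card_inversions_rf_comp:
  assumes "s \<in> D" "set ss \<subseteq> rf ` D" "0 < s (word_prod ss p)"
  shows "card (inversions (rf s \<circ> word_prod ss)) = Suc (card (inversions (word_prod ss)))"
proof -
  have sR: "s \<in> R"
    using assms D_subset by blast
  have eq: "inversions (rf s \<circ> word_prod ss) = insert s ((\<lambda>a. a \<circ> rf s) ` inversions (word_prod ss))"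
    using inversions_rf_comp[OF assms(1) word_in_G[OF assms(2)]] assms(3)
    by (auto simp: inversions_def)
  have "inj_on (\<lambda>a. a \<circ> rf s) (inversions (word_prod ss))"
    by (rule inj_on_inverseI[where g = "\<lambda>a. a \<circ> rf s"])
      (metis comp_assoc comp_id rf_rf[OF sR])
  moreover have "s \<noteq> a \<circ> rf s" if "a \<in> inversions (word_prod ss)" for a
  proof
    assume "s = a \<circ> rf s"
    then have "s \<circ> rf s = a"
      using rf_rf[OF sR] by (metis comp_assoc comp_id)
    then have "a p < 0"
      using root_rf_self[OF sR] D_pos[OF assms(1)] by auto
    then show False
      using that by (simp add: inversions_def)
  qed
  ultimately show ?thesis
    unfolding eq using finite_inversions_word[OF assms(2)]
    by (subst card_insert_disjoint) (auto simp: card_image)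
qed

text \<open>The strong exchange condition, reduced to lengths. The first letter \<open>rf s\<close>
  cancels if \<open>a = s\<close>; otherwise \<open>a \<circ> rf s\<close> is still positive at
  \<open>p\<close> and negative after the remaining word, and conjugation by \<open>rf s\<close>
  carries the shortening back.\<close>

lemma exchange:
  assumes "set ss \<subseteq> rf ` D" "a \<in> R" "0 < a p" "a (word_prod ss p) < 0"
  shows "\<exists>ts. set ts \<subseteq> rf ` D \<and> length ts < length ss \<and> rf a \<circ> word_prod ss = word_prod ts"
  using assms
proof (induction ss arbitrary: a)
  case (Cons x ss)
  then obtain s where s: "x = rf s" "s \<in> D"
    by auto
  then have sR: "s \<in> R"
    using D_subset by blast
  show ?case
  proof (cases "a = s")
    case True
    then have "rf a \<circ> word_prod (x # ss) = (rf s \<circ> rf s) \<circ> word_prod ss"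
      unfolding s(1) by (simp only: word_prod.simps o_assoc)
    also have "\<dots> = word_prod ss"
      by (simp only: rf_rf[OF sR] id_comp)
    finally have "rf a \<circ> word_prod (x # ss) = word_prod ss" .
    moreover have "set ss \<subseteq> rf ` D" "length ss < length (x # ss)"
      using Cons.prems(1) by auto
    ultimately show ?thesis
      by blast
  next
    case False
    define b where "b = a \<circ> rf s"
    have ss: "set ss \<subseteq> rf ` D"
      using Cons.prems(1) by simp
    have "b \<in> R" "0 < b p" "b (word_prod ss p) < 0"
      using Cons.prems False s root_rf[OF _ sR] rf_D_pos[OF s(2)] by (auto simp: b_def)
    then obtain ts where ts: "set ts \<subseteq> rf ` D" "length ts < length ss"
        "rf b \<circ> word_prod ss = word_prod ts"
      using Cons.IH[OF ss] by blast
    have "word_prod (x # ts) = (rf s \<circ> rf s) \<circ> rf a \<circ> rf s \<circ> word_prod ss"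
      unfolding word_prod.simps s(1) ts(3)[symmetric] b_def rf_conj[OF Cons.prems(2) sR]
      by (simp only: o_assoc)
    also have "\<dots> = rf a \<circ> word_prod (x # ss)"
      unfolding rf_rf[OF sR] s(1) by (simp only: word_prod.simps o_assoc id_comp)
    finally have "rf a \<circ> word_prod (x # ss) = word_prod (x # ts)"
      by (rule sym)
    moreover have "set (x # ts) \<subseteq> rf ` D" "length (x # ts) < length (x # ss)"
      using ts Cons.prems(1) by auto
    ultimately show ?thesis
      by blast
  qed
qed auto

text \<open>Each letter of a reduced word, read from the right, adds one inversion: otherwise the
  exchange condition would yield a shorter word.\<close>

lemma card_inversions_reduced:
  assumes "set ss \<subseteq> rf ` D" "length ss = word_length (rf ` D) (word_prod ss)"
  shows "card (inversions (word_prod ss)) = length ss"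
  using assms
proof (induction ss)
  case (Cons x ss)
  then obtain s where s: "x = rf s" "s \<in> D"
    by auto
  have reduced: "length ss < length ts"
    if "set ts \<subseteq> rf ` D" "word_prod ts = x \<circ> word_prod ss" for ts
    using word_length_le[OF that(1)] that(2) Cons.prems(2)
    by (simp only: word_prod.simps list.size)
  have ss: "set ss \<subseteq> rf ` D"
    using Cons.prems by simp
  obtain ts where ts: "set ts \<subseteq> rf ` D" "word_prod ts = word_prod ss"
      "length ts = word_length (rf ` D) (word_prod ss)"
    using reduced_word_exists[OF ss] by blast
  \<comment> \<open>\<open>x # ts\<close> expresses the same element as \<open>x # ss\<close>, so a
    tail of a reduced word is reduced, as the induction hypothesis requires.\<close>
  have "length ss \<le> length ts"
    using reduced[of "x # ts"] ts Cons.prems(1) by simp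
  then have "card (inversions (word_prod ss)) = length ss"
    using Cons.IH ss ts(3) word_length_le[OF ss] by simp
  moreover have "\<not> s (word_prod ss p) < 0"
  proof
    assume *: "s (word_prod ss p) < 0"
    obtain ts where "set ts \<subseteq> rf ` D" "length ts < length ss" "rf s \<circ> word_prod ss = word_prod ts"
      using exchange[of ss s, OF ss subsetD[OF D_subset s(2)] D_pos[OF s(2)] *] by blast
    then show False
      using reduced[of ts] s(1) by simp
  qed
  then have "0 < s (word_prod ss p)"
    using root_nonzero[OF root_comp_word[OF ss]] s(2) D_subset by fastforce
  ultimately have "card (inversions (rf s \<circ> word_prod ss)) = length (x # ss)"
    using card_inversions_rf_comp[OF s(2) ss] by simp
  then show ?case
    by (simp only: word_prod.simps s(1))
qed (simp add: inversions_id)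

lemma word_length_eq_card_inversions:
  assumes "w \<in> G"
  shows "word_length (rf ` D) w = card (inversions w)"
proof -
  obtain ss where "set ss \<subseteq> rf ` D" "w = word_prod ss" "length ss = word_length (rf ` D) w"
    using assms reduced_word_exists unfolding G_def by (smt (verit) mem_Collect_eq)
  then show ?thesis
    using card_inversions_reduced by metis
qed

lemma word_length_rf_comp_less:
  assumes "w \<in> G" "a \<in> R" "0 < a p" "a (w p) < 0"
  shows "word_length (rf ` D) (rf a \<circ> w) < word_length (rf ` D) w"
proof -
  obtain ss where ss: "set ss \<subseteq> rf ` D" "w = word_prod ss" "length ss = word_length (rf ` D) w"
    using assms(1) reduced_word_exists unfolding G_def by (smt (verit) mem_Collect_eq)
  then show ?thesis
    using exchange[OF ss(1) assms(2,3)] assms(4) word_length_le by (metis order_le_less_trans)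
qed

text \<open>If \<open>a\<close> is positive at \<open>w p\<close>, it is negative at
  \<open>rf a (w p)\<close>, and the preceding lemma applies to \<open>rf a \<circ> w\<close>, which
  \<open>rf a\<close> takes back to \<open>w\<close>.\<close>

lemma word_length_less_rf_comp_iff:
  assumes "w \<in> G" "a \<in> R" "0 < a p"
  shows "word_length (rf ` D) w < word_length (rf ` D) (rf a \<circ> w) \<longleftrightarrow> 0 < a (w p)"
proof (cases "0 < a (w p)")
  case True
  have "word_length (rf ` D) (rf a \<circ> (rf a \<circ> w)) < word_length (rf ` D) (rf a \<circ> w)"
    by (rule word_length_rf_comp_less)
      (use assms True rf_in_G comp_in_G root_rf_self[OF assms(2)] in auto)
  then show ?thesis
    using True by (simp only: o_assoc rf_rf[OF assms(2)] id_comp)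
next
  case False
  then have "a (w p) < 0"
    using root_nonzero[OF root_comp_G[OF assms(1,2)]] by simp
  then show ?thesis
    using word_length_rf_comp_less[OF assms] False by simp
qed

section \<open>Inverses and multiplication on the right\<close>

lemma word_prod_rev:
  assumes "set ss \<subseteq> rf ` D"
  shows "word_prod (rev ss) \<circ> word_prod ss = id"
  using assms
proof (induction ss)
  case (Cons x ss)
  have "word_prod (rev (x # ss)) \<circ> word_prod (x # ss) =
      word_prod (rev ss) \<circ> (x \<circ> x) \<circ> word_prod ss"
    by (simp only: rev.simps word_prod_append) (simp add: o_assoc)
  also have "x \<circ> x = id"
    using Cons.prems D_subset rf_rf by auto
  finally show ?case
    using Cons by simp
qed simp

lemma inv_word_prod:
  assumes "set ss \<subseteq> rf ` D"
  shows "bij (word_prod ss)" "inv (word_prod ss) = word_prod (rev ss)"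
proof -
  have "word_prod (rev ss) \<circ> word_prod ss = id" "word_prod ss \<circ> word_prod (rev ss) = id"
    using word_prod_rev[of ss] word_prod_rev[of "rev ss"] assms by auto
  then show "bij (word_prod ss)" "inv (word_prod ss) = word_prod (rev ss)"
    by (auto intro: o_bij inv_unique_comp)
qed

lemma bij_G: "w \<in> G \<Longrightarrow> bij w"
  using inv_word_prod(1) by (auto simp: G_def)

lemma inv_in_G: "w \<in> G \<Longrightarrow> inv w \<in> G"
  using inv_word_prod(2) word_in_G by (auto simp: G_def)

lemma word_length_inv:
  assumes "w \<in> G"
  shows "word_length (rf ` D) (inv w) = word_length (rf ` D) w"
proof -
  have le: "word_length (rf ` D) (inv w) \<le> word_length (rf ` D) w" if w: "w \<in> G" for w
  proof -
    obtain ss where ss: "set ss \<subseteq> rf ` D" "w = word_prod ss" "length ss = word_length (rf ` D) w"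
      using w reduced_word_exists unfolding G_def by (smt (verit) mem_Collect_eq)
    then show ?thesis
      using word_length_le[of "rev ss" "rf ` D"] inv_word_prod(2)[OF ss(1)] by simp
  qed
  show ?thesis
    using le[OF assms] le[OF inv_in_G[OF assms]] inv_inv_eq[OF bij_G[OF assms]] by simp
qed

text \<open>Inversion preserves length and turns multiplication by \<open>rf a\<close> on the right
  into multiplication on the left.\<close>

lemma word_length_less_comp_rf_iff:
  assumes "w \<in> G" "a \<in> R" "0 < a p"
  shows "word_length (rf ` D) w < word_length (rf ` D) (w \<circ> rf a) \<longleftrightarrow> 0 < a (inv w p)"
proof -
  have rf: "rf a \<in> G" "inv (rf a) = rf a"
    using rf_in_G assms rf_rf inv_unique_comp by blast+
  have "inv (w \<circ> rf a) = rf a \<circ> inv w"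
    using o_inv_distrib[OF bij_G bij_G] assms(1) rf by simp
  then show ?thesis
    using word_length_less_rf_comp_iff[OF inv_in_G assms(2,3)] assms(1) rf comp_in_G
      word_length_inv by metis
qed

lemma rf_comp_word:
  "set ss \<subseteq> rf ` D \<Longrightarrow> a \<in> R \<Longrightarrow> rf (a \<circ> word_prod ss) = word_prod (rev ss) \<circ> rf a \<circ> word_prod ss"
proof (induction ss arbitrary: a)
  case (Cons x ss)
  then obtain s where s: "x = rf s" "s \<in> D"
    by auto
  then have sR: "s \<in> R"
    using D_subset by blast
  have "rf ((a \<circ> rf s) \<circ> word_prod ss) = word_prod (rev ss) \<circ> rf (a \<circ> rf s) \<circ> word_prod ss"
    by (rule Cons.IH[OF _ root_rf[OF Cons.prems(2) sR]]) (use Cons.prems(1) in simp)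
  then have "rf (a \<circ> word_prod (x # ss)) =
      word_prod (rev ss) \<circ> (rf s \<circ> rf a \<circ> rf s) \<circ> word_prod ss"
    unfolding rf_conj[OF Cons.prems(2) sR] by (simp only: word_prod.simps o_assoc s(1))
  moreover have "word_prod (rev (x # ss)) = word_prod (rev ss) \<circ> rf s"
    by (simp add: word_prod_append s(1))
  ultimately show ?case
    by (simp only: word_prod.simps o_assoc s(1))
qed simp

text \<open>This identifies every conjugate of a generator as the reflection of a root.\<close>

lemma rf_comp_G:
  assumes "w \<in> G" "a \<in> R"
  shows "rf (a \<circ> w) = inv w \<circ> rf a \<circ> w"
  using assms rf_comp_word inv_word_prod(2) by (auto simp: G_def)

lemma finite_word_length:
  assumes "finite D"
  shows "finite {w \<in> G. word_length (rf ` D) w = n}"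
proof (rule finite_subset)
  show "{w \<in> G. word_length (rf ` D) w = n} \<subseteq> word_prod ` {ss. set ss \<subseteq> rf ` D \<and> length ss = n}"
    using reduced_word_exists unfolding G_def by (smt (verit, best) image_iff mem_Collect_eq subsetI)
  show "finite (word_prod ` {ss. set ss \<subseteq> rf ` D \<and> length ss = n})"
    using assms by (intro finite_imageI finite_lists_length_eq)
qed

end

section \<open>Transformation groups\<close>

text \<open>The hull is an intersection, and the family intersected must be nonempty; the group of
  all bijections belongs to it and makes every element of the hull a bijection.\<close>

lemma transformation_group_hull:
  assumes "\<And>f. f \<in> X \<Longrightarrow> bij f"
  shows "transformation_group (transformation_group hull X)"
proof -
  have "transformation_group {f :: 'a \<Rightarrow> 'a. bij f}"
    by (auto simp: transformation_group_def bij_comp bij_imp_bij_inv)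
  then have "f \<in> transformation_group hull X \<Longrightarrow> bij f" for f
    using assms unfolding hull_def by blast
  then show ?thesis
    by (auto simp: transformation_group_def hull_def)
qed

lemma inner_coroot_self: "a \<noteq> 0 \<Longrightarrow> a \<bullet> coroot a = 2"
  by (simp add: coroot_def)

lemma affine_reflection_affine_reflection:
  assumes "a \<noteq> 0"
  shows "affine_reflection a k \<circ> affine_reflection a k = id"
proof
  fix v
  have "affine_reflection a k v \<bullet> a - k = - (v \<bullet> a - k)"
    using inner_coroot_self[OF assms]
    by (simp add: affine_reflection_def inner_diff_left inner_commute[of "coroot a"])
  then have "affine_reflection a k (affine_reflection a k v) =
      affine_reflection a k v - (- (v \<bullet> a - k)) *\<^sub>R coroot a"
    unfolding affine_reflection_def[of a k "affine_reflection a k v"] by (simp only:)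
  then show "(affine_reflection a k \<circ> affine_reflection a k) v = id v"
    by (simp add: affine_reflection_def algebra_simps)
qed

lemma reflection_eq_affine_reflection: "reflection a = affine_reflection a 0"
  by (auto simp: reflection_def affine_reflection_def)

lemma bij_affine_reflection:
  assumes "a \<noteq> 0"
  shows "bij (affine_reflection a k)"
  using affine_reflection_affine_reflection[OF assms] by (rule o_bij) (rule affine_reflection_affine_reflection[OF assms])

section \<open>Affine roots\<close>

definition affine_root :: "'a::euclidean_space \<Rightarrow> int \<Rightarrow> 'a \<Rightarrow> real" where
  "affine_root a k v = v \<bullet> a + of_int k"

text \<open>For an affine function \<open>f\<close>, the vector representing its linear part.\<close>

definition grad :: "('a::euclidean_space \<Rightarrow> real) \<Rightarrow> 'a" where
  "grad f = (\<Sum>i\<in>Basis. (f i - f 0) *\<^sub>R i)"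

text \<open>The arrangement hands over a root only as a function, so its direction has to be
  recovered by \<open>grad\<close>.\<close>

definition root_reflection :: "('a::euclidean_space \<Rightarrow> real) \<Rightarrow> 'a \<Rightarrow> 'a" where
  "root_reflection f v = v - f v *\<^sub>R coroot (grad f)"

lemma grad_affine_root [simp]: "grad (affine_root a k) = a"
  by (simp add: grad_def affine_root_def inner_commute[of _ a] euclidean_representation)

lemma root_reflection_affine_root:
  "root_reflection (affine_root a k) = affine_reflection a (- of_int k)"
  by (auto simp: fun_eq_iff root_reflection_def affine_reflection_def affine_root_def)

definition affine_roots :: "'a::euclidean_space set \<Rightarrow> ('a \<Rightarrow> real) set" where
  "affine_roots \<Phi> = {affine_root a k |a k. a \<in> \<Phi>}"

lemma affine_rootE:
  assumes "f \<in> affine_roots \<Phi>"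
  obtains a k where "f = affine_root a k" "a \<in> \<Phi>"
  using assms by (auto simp: affine_roots_def)

lemma affine_root_inj: "affine_root a k = affine_root b l \<longleftrightarrow> a = b \<and> k = l"
proof
  assume eq: "affine_root a k = affine_root b l"
  then have "a = b"
    by (metis grad_affine_root)
  moreover have "k = l"
    using fun_cong[OF eq, of 0] by (simp add: affine_root_def)
  ultimately show "a = b \<and> k = l"
    by simp
qed simp

lemma coroot_minus: "coroot (- a) = - coroot a"
  by (simp add: coroot_def)

lemma affine_reflection_minus: "affine_reflection (- a) k = affine_reflection a (- k)"
  by (auto simp: fun_eq_iff affine_reflection_def coroot_minus algebra_simps)

lemma inner_reflection: "reflection a v \<bullet> reflection a w = v \<bullet> w"
  by (cases "a = 0") (simp_all add: reflection_def coroot_def inner_diff_left inner_diff_right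
      inner_commute field_simps)

lemma linear_reflection: "linear (reflection a)"
  by (rule linearI) (auto simp: reflection_def inner_add_left algebra_simps)

lemma reflection_coroot: "reflection a (coroot b) = coroot (reflection a b)"
  by (simp add: coroot_def inner_reflection linear_scale[OF linear_reflection])

lemma affine_reflection_diff:
  "affine_reflection a k (v - w) = affine_reflection a k v - reflection a w"
  by (auto simp: affine_reflection_def reflection_def algebra_simps)

lemma inner_reflection_right: "v \<bullet> reflection a b = v \<bullet> b - (v \<bullet> a) * (coroot a \<bullet> b)"
  by (simp add: reflection_def coroot_def inner_diff_right inner_commute)

text \<open>Integrality of the pairing keeps the constant term an integer; this is why reflections
  preserve the set of affine roots.\<close>

lemma affine_root_comp_affine_reflection:
  assumes "coroot b \<bullet> a = of_int n"
  shows "affine_root a k \<circ> affine_reflection b (of_int l) = affine_root (reflection b a) (k + l * n)"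
  using assms
  by (auto simp: fun_eq_iff affine_root_def affine_reflection_def inner_reflection_right
      inner_diff_left algebra_simps)

lemma root_reflection_comp:
  assumes "coroot b \<bullet> a = of_int n" "b \<noteq> 0"
  shows "root_reflection (affine_root a k \<circ> root_reflection (affine_root b l)) =
    root_reflection (affine_root b l) \<circ> root_reflection (affine_root a k) \<circ>
    root_reflection (affine_root b l)"
proof
  fix v
  let ?r = "affine_reflection b (of_int (- l))"
  have rl: "root_reflection (affine_root b l) = ?r"
    by (simp add: root_reflection_affine_root)
  have "grad (affine_root a k \<circ> ?r) = reflection b a"
    unfolding affine_root_comp_affine_reflection[OF assms(1)] by simp
  then have "root_reflection (affine_root a k \<circ> ?r) v =
      v - affine_root a k (?r v) *\<^sub>R reflection b (coroot a)"
    by (simp add: root_reflection_def reflection_coroot)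
  \<comment> \<open>Writing \<open>v\<close> as \<open>?r (?r v)\<close> allows the affine map
    \<open>?r\<close> to be pulled out of the difference.\<close>
  also have "\<dots> = ?r (?r v) - affine_root a k (?r v) *\<^sub>R reflection b (coroot a)"
    using fun_cong[OF affine_reflection_affine_reflection[OF assms(2)], of "of_int (- l)" v] by simp
  also have "\<dots> = ?r (root_reflection (affine_root a k) (?r v))"
    by (simp add: root_reflection_def affine_reflection_diff linear_scale[OF linear_reflection])
  finally show "root_reflection (affine_root a k \<circ> root_reflection (affine_root b l)) v =
      (root_reflection (affine_root b l) \<circ> root_reflection (affine_root a k) \<circ>
       root_reflection (affine_root b l)) v"
    unfolding rl by (simp only: comp_apply)
qed

section \<open>The alcove\<close>

locale based_root_system =
  fixes \<Phi> \<Delta> :: "'a::euclidean_space set" and \<theta> :: 'a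
  assumes root_system: "root_system \<Phi>"
    and simple_system: "simple_system \<Phi> \<Delta>"
    and highest_root: "highest_root \<Phi> \<Delta> \<theta>"
begin

lemma root_neq_0: "a \<in> \<Phi> \<Longrightarrow> a \<noteq> 0"
  and finite_roots: "finite \<Phi>"
  and reflection_root: "a \<in> \<Phi> \<Longrightarrow> b \<in> \<Phi> \<Longrightarrow> reflection a b \<in> \<Phi>"
  and reduced: "a \<in> \<Phi> \<Longrightarrow> c *\<^sub>R a \<in> \<Phi> \<Longrightarrow> c = 1 \<or> c = -1"
  and span_roots: "span \<Phi> = UNIV"
  using root_system by (auto simp: root_system_def)

lemma coroot_int:
  assumes "a \<in> \<Phi>" "b \<in> \<Phi>"
  obtains n where "coroot b \<bullet> a = of_int n"
proof -
  have "coroot b \<bullet> a \<in> \<int>"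
    using root_system assms by (auto simp: root_system_def inner_commute)
  then show thesis
    using that by (elim Ints_cases)
qed

lemma uminus_root: "a \<in> \<Phi> \<Longrightarrow> - a \<in> \<Phi>"
  using reflection_root[of a a] root_neq_0[of a]
  by (simp add: reflection_def coroot_def scaleR_2)

lemma simple_root: "a \<in> \<Delta> \<Longrightarrow> a \<in> \<Phi>"
  and independent_simple: "independent \<Delta>"
  and theta_root: "\<theta> \<in> \<Phi>"
  using simple_system highest_root by (auto simp: simple_system_def highest_root_def)

lemma finite_simple: "finite \<Delta>"
  using finite_roots simple_root by (meson finite_subset subsetI)

text \<open>A linear functional may take any values on an independent set, and its adjoint at 1 is
  the vector representing it.\<close>

lemma simple_roots_dual_point:
  fixes f :: "'a \<Rightarrow> real"
  obtains v where "\<And>a. a \<in> \<Delta> \<Longrightarrow> v \<bullet> a = f a"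
proof -
  obtain g where g: "linear g" "\<And>a. a \<in> \<Delta> \<Longrightarrow> g a = f a"
    using linear_independent_extend[OF independent_simple] by metis
  have "adjoint g 1 \<bullet> a = g a" for a
    using adjoint_works[OF g(1), of a 1] by (simp add: inner_commute)
  then show thesis
    using that[of "adjoint g 1"] g(2) by simp
qed

text \<open>Real coefficients, unlike those in \<open>nonneg_comb\<close>, permit the halving that
  places \<open>\<theta>\<close> itself in the cone.\<close>

definition root_cone :: "'a set" where
  "root_cone = {\<Sum>a\<in>\<Delta>. c a *\<^sub>R a |c. \<forall>a. 0 \<le> c a}"

lemma root_coneI: "(\<And>a. 0 \<le> c a) \<Longrightarrow> (\<Sum>a\<in>\<Delta>. c a *\<^sub>R a) \<in> root_cone"
  by (auto simp: root_cone_def)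

lemma root_coneE:
  assumes "x \<in> root_cone"
  obtains c where "\<And>a. 0 \<le> c a" "x = (\<Sum>a\<in>\<Delta>. c a *\<^sub>R a)"
  using assms by (auto simp: root_cone_def)

lemma root_cone_add: "x \<in> root_cone \<Longrightarrow> y \<in> root_cone \<Longrightarrow> x + y \<in> root_cone"
  by (elim root_coneE) (auto simp: sum.distrib[symmetric] scaleR_left_distrib[symmetric]
      intro!: root_coneI)

lemma root_cone_scaleR: "0 \<le> t \<Longrightarrow> x \<in> root_cone \<Longrightarrow> t *\<^sub>R x \<in> root_cone"
  by (elim root_coneE) (auto simp: scaleR_right.sum intro!: root_coneI)

lemma nonneg_comb_root_cone: "nonneg_comb \<Delta> x \<Longrightarrow> x \<in> root_cone"
  by (auto simp: nonneg_comb_def intro: root_coneI)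

lemma theta_diff_cone: "b \<in> \<Phi> \<Longrightarrow> \<theta> - b \<in> root_cone"
  using highest_root nonneg_comb_root_cone by (auto simp: highest_root_def)

lemma root_cone_cases: "b \<in> \<Phi> \<Longrightarrow> b \<in> root_cone \<or> - b \<in> root_cone"
  using simple_system nonneg_comb_root_cone by (auto simp: simple_system_def)

text \<open>The highest root dominates \<open>- \<theta>\<close> as well, so twice
  \<open>\<theta>\<close> lies in the cone.\<close>

lemma theta_cone: "\<theta> \<in> root_cone"
proof -
  have "(1/2) *\<^sub>R (\<theta> - - \<theta>) \<in> root_cone"
    by (intro root_cone_scaleR theta_diff_cone uminus_root theta_root) auto
  then show ?thesis
    by (simp add: scaleR_add_right flip: scaleR_left_distrib)
qed

lemma root_cone_inner_nonneg:
  assumes "x \<in> root_cone" "\<And>a. a \<in> \<Delta> \<Longrightarrow> 0 \<le> v \<bullet> a"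
  shows "0 \<le> v \<bullet> x"
  using assms by (elim root_coneE) (auto simp: inner_sum_right intro!: sum_nonneg)

lemma root_cone_inner_pos:
  assumes "x \<in> root_cone" "x \<noteq> 0" "\<And>a. a \<in> \<Delta> \<Longrightarrow> 0 < v \<bullet> a"
  shows "0 < v \<bullet> x"
proof -
  obtain c where c: "\<And>a. 0 \<le> c a" "x = (\<Sum>a\<in>\<Delta>. c a *\<^sub>R a)"
    using root_coneE[OF assms(1)] by blast
  then obtain a where a: "a \<in> \<Delta>" "c a \<noteq> 0"
    using assms(2) by (metis (no_types, lifting) scaleR_zero_left sum.neutral)
  have "0 < (\<Sum>a\<in>\<Delta>. c a * (v \<bullet> a))"
    by (rule sum_pos2[OF finite_simple a(1)])
      (use c a assms(3) in \<open>auto simp: less_le intro!: mult_nonneg_nonneg\<close>)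
  then show ?thesis
    by (simp add: c(2) inner_sum_right)
qed

text \<open>The walls of the fundamental alcove, each with the sign that is positive inside;
  \<open>affine_root (- \<theta>) 1\<close> is the function
  \<open>1 - v \<bullet> \<theta>\<close>.\<close>

definition simple_affine_roots :: "('a \<Rightarrow> real) set" where
  "simple_affine_roots = insert (affine_root (- \<theta>) 1) ((\<lambda>a. affine_root a 0) ` \<Delta>)"

lemma root_reflection_simple_affine_roots:
  "root_reflection ` simple_affine_roots = affine_generators \<Delta> \<theta>"
  by (simp add: simple_affine_roots_def affine_generators_def image_image
      root_reflection_affine_root affine_reflection_minus reflection_eq_affine_reflection)

lemma simple_affine_roots_subset: "simple_affine_roots \<subseteq> affine_roots \<Phi>"
  using simple_root theta_root uminus_root by (auto simp: simple_affine_roots_def affine_roots_def)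

lemma theta_inner_pos: "(\<And>a. a \<in> \<Delta> \<Longrightarrow> 0 < v \<bullet> a) \<Longrightarrow> 0 < v \<bullet> \<theta>"
  using root_cone_inner_pos[OF theta_cone] root_neq_0[OF theta_root] by blast

lemma alcove_point_exists:
  obtains p where "\<And>a. a \<in> \<Delta> \<Longrightarrow> 0 < p \<bullet> a" "p \<bullet> \<theta> < 1"
proof -
  obtain v where v: "\<And>a. a \<in> \<Delta> \<Longrightarrow> v \<bullet> a = 1"
    using simple_roots_dual_point[of "\<lambda>_. 1"] by blast
  then have "0 < v \<bullet> \<theta>"
    by (intro theta_inner_pos) simp
  then show thesis
    \<comment> \<open>With \<open>t = v \<bullet> \<theta>\<close> the scaled point pairs with
      \<open>\<theta>\<close> to \<open>t / (1 + t) < 1\<close>.\<close>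
    using that[of "(1 / (1 + v \<bullet> \<theta>)) *\<^sub>R v"] v by (simp add: field_simps)
qed

text \<open>On the wall of \<open>\<theta>\<close>, a vector positive on all simple roots is scaled
  to level 1. On a simple wall, a vector vanishing on that simple root alone is shrunk to below
  level 1; the added 1 in the denominator covers \<open>v \<bullet> \<theta> = 0\<close>.\<close>

lemma facet_point_exists:
  assumes "s \<in> simple_affine_roots"
  obtains v where "s v = 0" "\<And>t. t \<in> simple_affine_roots \<Longrightarrow> t \<noteq> s \<Longrightarrow> 0 < t v"
proof (cases "s = affine_root (- \<theta>) 1")
  case True
  obtain v where v: "\<And>a. a \<in> \<Delta> \<Longrightarrow> v \<bullet> a = 1"
    using simple_roots_dual_point[of "\<lambda>_. 1"] by blast
  then have "0 < v \<bullet> \<theta>"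
    by (intro theta_inner_pos) simp
  then have "s ((1 / (v \<bullet> \<theta>)) *\<^sub>R v) = 0"
      "t \<in> simple_affine_roots \<Longrightarrow> t \<noteq> s \<Longrightarrow> 0 < t ((1 / (v \<bullet> \<theta>)) *\<^sub>R v)" for t
    using v True by (auto simp: simple_affine_roots_def affine_root_def)
  then show thesis
    using that by blast
next
  case False
  then obtain b where b: "b \<in> \<Delta>" "s = affine_root b 0"
    using assms by (auto simp: simple_affine_roots_def)
  obtain v where v: "\<And>a. a \<in> \<Delta> \<Longrightarrow> v \<bullet> a = (if a = b then 0 else 1)"
    using simple_roots_dual_point[of "\<lambda>a. if a = b then 0 else 1"] by blast
  then have "0 \<le> v \<bullet> \<theta>"
    by (intro root_cone_inner_nonneg[OF theta_cone]) simp
  then have "s ((1 / (1 + v \<bullet> \<theta>)) *\<^sub>R v) = 0"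
      "t \<in> simple_affine_roots \<Longrightarrow> t \<noteq> s \<Longrightarrow> 0 < t ((1 / (1 + v \<bullet> \<theta>)) *\<^sub>R v)" for t
    using v b by (auto simp: simple_affine_roots_def affine_root_def field_simps split: if_splits)
  then show thesis
    using that by blast
qed

end

locale alcove = based_root_system +
  fixes p :: 'a
  assumes p_simple: "\<And>a. a \<in> \<Delta> \<Longrightarrow> 0 < p \<bullet> a" and p_theta: "p \<bullet> \<theta> < 1"
begin

section \<open>Positive affine roots and the arrangement axioms\<close>

lemma inner_p_less_1: "b \<in> \<Phi> \<Longrightarrow> p \<bullet> b < 1"
  using root_cone_inner_nonneg[OF theta_diff_cone, of b p] p_simple p_theta
  by (force simp: inner_diff_right)

lemma inner_p_bounds:
  assumes "b \<in> \<Phi>"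
  shows "p \<bullet> b < 1" "- 1 < p \<bullet> b" "p \<bullet> b \<noteq> 0"
proof -
  show "p \<bullet> b < 1" "- 1 < p \<bullet> b"
    using inner_p_less_1[OF assms] inner_p_less_1[OF uminus_root[OF assms]] by auto
  show "p \<bullet> b \<noteq> 0"
    using root_cone_cases[OF assms] root_cone_inner_pos[of _ p] p_simple root_neq_0[OF assms]
    by force
qed

lemma affine_root_p_nonzero: "f \<in> affine_roots \<Phi> \<Longrightarrow> f p \<noteq> 0"
proof (elim affine_rootE)
  fix a k
  assume "f = affine_root a k" "a \<in> \<Phi>"
  then show "f p \<noteq> 0"
    using inner_p_bounds[of a] by (cases "k = 0") (auto simp: affine_root_def)
qed

text \<open>For \<open>f\<close> given by \<open>b\<close> and \<open>k\<close>, one has \<open>f v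
  = v \<bullet> (b + k \<theta>) + k (1 - v \<bullet> \<theta>)\<close>. Since
  \<open>p \<bullet> b < 1\<close>, positivity at \<open>p\<close> forces \<open>k \<ge> 0\<close>,
  and \<open>b + k \<theta>\<close> lies in the root cone: for \<open>k = 0\<close> because
  \<open>b\<close> is positive, and for \<open>k \<ge> 1\<close> because \<open>\<theta>\<close>
  dominates \<open>- b\<close>.\<close>

lemma positive_affine_root_decomposition:
  assumes "f \<in> affine_roots \<Phi>" "0 < f p"
  obtains c d where "\<And>a. 0 \<le> c a" "0 \<le> d"
    "\<And>v. f v = (\<Sum>a\<in>\<Delta>. c a * affine_root a 0 v) + d * affine_root (- \<theta>) 1 v"
    "grad f = (\<Sum>a\<in>\<Delta>. c a *\<^sub>R a) - d *\<^sub>R \<theta>"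
proof -
  obtain b k where bk: "f = affine_root b k" "b \<in> \<Phi>"
    using affine_rootE[OF assms(1)] by blast
  have "0 \<le> k"
    using assms(2) inner_p_bounds[OF bk(2)] unfolding bk(1) affine_root_def by linarith
  have "b + of_int k *\<^sub>R \<theta> \<in> root_cone"
  proof (cases "k = 0")
    case True
    then have "0 < p \<bullet> b"
      using assms(2) by (simp add: bk affine_root_def)
    then have "- b \<notin> root_cone"
      using root_cone_inner_nonneg[of "- b" p] p_simple by force
    then show ?thesis
      using root_cone_cases[OF bk(2)] True by simp
  next
    case False
    have "b + of_int k *\<^sub>R \<theta> = (\<theta> - - b) + of_int (k - 1) *\<^sub>R \<theta>"
      by (simp add: algebra_simps)
    also have "\<dots> \<in> root_cone"
      using False \<open>0 \<le> k\<close> bk(2)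
      by (intro root_cone_add root_cone_scaleR theta_diff_cone uminus_root theta_cone) auto
    finally show ?thesis .
  qed
  then obtain c where c: "\<And>a. 0 \<le> c a" "b + of_int k *\<^sub>R \<theta> = (\<Sum>a\<in>\<Delta>. c a *\<^sub>R a)"
    by (elim root_coneE) blast
  then have b: "b = (\<Sum>a\<in>\<Delta>. c a *\<^sub>R a) - of_int k *\<^sub>R \<theta>"
    by (metis add_diff_cancel_right')
  have "f v = (\<Sum>a\<in>\<Delta>. c a * affine_root a 0 v) + of_int k * affine_root (- \<theta>) 1 v" for v
    unfolding bk(1) affine_root_def by (subst b) (simp add: inner_diff_right inner_sum_right algebra_simps)
  then show thesis
    using that[of c "of_int k"] c(1) b \<open>0 \<le> k\<close> bk(1) by (simp add: fun_eq_iff)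
qed

lemma affine_root_multiple:
  assumes "f \<in> affine_roots \<Phi>" "s \<in> affine_roots \<Phi>" "\<And>v. f v = c * s v" "0 \<le> c"
  shows "f = s"
proof -
  obtain a k where a: "f = affine_root a k" "a \<in> \<Phi>"
    using affine_rootE[OF assms(1)] by blast
  obtain b l where b: "s = affine_root b l" "b \<in> \<Phi>"
    using affine_rootE[OF assms(2)] by blast
  have "a = grad f"
    by (simp add: a)
  also have "\<dots> = c *\<^sub>R grad s"
    unfolding grad_def scaleR_right.sum by (rule sum.cong) (auto simp: assms(3) algebra_simps)
  finally have "c *\<^sub>R b \<in> \<Phi>"
    using a b by simp
  then have "c = 1"
    using reduced[OF b(2)] assms(4) by force
  then show ?thesis
    using assms(3) by (simp add: fun_eq_iff)
qed

text \<open>All is tested at a point \<open>v\<close> interior to the facet of \<open>s\<close>,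
  which the reflection fixes: if the reflected root were negative at \<open>p\<close>, then
  \<open>f v \<le> 0\<close>, and this makes \<open>f\<close> a multiple of
  \<open>s\<close>.\<close>

lemma root_reflection_simple_pos:
  assumes "s \<in> simple_affine_roots" "f \<in> affine_roots \<Phi>" "0 < f p" "f \<noteq> s"
    and fs: "f \<circ> root_reflection s \<in> affine_roots \<Phi>"
  shows "0 < f (root_reflection s p)"
proof (rule ccontr)
  let ?g = "f \<circ> root_reflection s"
  obtain v where v: "s v = 0" "\<And>t. t \<in> simple_affine_roots \<Longrightarrow> t \<noteq> s \<Longrightarrow> 0 < t v"
    using facet_point_exists[OF assms(1)] by blast
  then have v_nonneg: "0 \<le> t v" if "t \<in> simple_affine_roots" for t
    using that by (cases "t = s") (auto intro: less_imp_le)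
  have D: "affine_root (- \<theta>) 1 \<in> simple_affine_roots"
      "a \<in> \<Delta> \<Longrightarrow> affine_root a 0 \<in> simple_affine_roots" for a
    by (auto simp: simple_affine_roots_def)
  have nonneg: "0 \<le> h v" if "h \<in> affine_roots \<Phi>" "0 < h p" for h
  proof -
    obtain c d where cd: "\<And>a. 0 \<le> c a" "0 \<le> d"
        "\<And>v. h v = (\<Sum>a\<in>\<Delta>. c a * affine_root a 0 v) + d * affine_root (- \<theta>) 1 v"
      by (rule positive_affine_root_decomposition[OF \<open>h \<in> _\<close> \<open>0 < h p\<close>]) (rule that)
    then show ?thesis
      unfolding cd(3) using v_nonneg[OF D(1)] v_nonneg[OF D(2)]
      by (intro add_nonneg_nonneg sum_nonneg mult_nonneg_nonneg) auto
  qed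
  assume "\<not> 0 < f (root_reflection s p)"
  then have neg: "?g p < 0"
    using affine_root_p_nonzero[OF fs] by simp
  obtain a k where ak: "?g = affine_root a k" "a \<in> \<Phi>"
    using affine_rootE[OF fs] by blast
  \<comment> \<open>The negative of \<open>?g\<close> is a root positive at \<open>p\<close>, hence
    a nonnegative combination of the walls and nonnegative at \<open>v\<close>.\<close>
  have "affine_root (- a) (- k) \<in> affine_roots \<Phi>" "affine_root (- a) (- k) v = - ?g v"
      "affine_root (- a) (- k) p = - ?g p"
    using ak uminus_root by (auto simp: affine_roots_def affine_root_def simp del: comp_apply)
  then have "?g v \<le> 0"
    using nonneg neg by (metis neg_0_le_iff_le neg_0_less_iff_less)
  moreover have "root_reflection s v = v"
    using v(1) by (simp add: root_reflection_def)
  ultimately have "f v \<le> 0"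
    by simp
  obtain c d where cd: "\<And>a. 0 \<le> c a" "0 \<le> d"
      "\<And>v. f v = (\<Sum>a\<in>\<Delta>. c a * affine_root a 0 v) + d * affine_root (- \<theta>) 1 v"
    by (rule positive_affine_root_decomposition[OF assms(2,3)]) (rule that)
  have c_nonneg: "0 \<le> c a * affine_root a 0 v" if "a \<in> \<Delta>" for a
    using cd(1) v_nonneg[OF D(2)[OF that]] by simp
  have d_nonneg: "0 \<le> d * affine_root (- \<theta>) 1 v"
    using cd(2) v_nonneg[OF D(1)] by simp
  have sum_nonneg: "0 \<le> (\<Sum>a\<in>\<Delta>. c a * affine_root a 0 v)"
    by (rule sum_nonneg) (rule c_nonneg)
  have zero: "(\<Sum>a\<in>\<Delta>. c a * affine_root a 0 v) = 0" "d * affine_root (- \<theta>) 1 v = 0"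
    using \<open>f v \<le> 0\<close> d_nonneg sum_nonneg cd(3)[of v] by linarith+
  have c_zero: "c a * affine_root a 0 v = 0" if "a \<in> \<Delta>" for a
    using zero(1) sum_nonneg_eq_0_iff[OF finite_simple, of "\<lambda>a. c a * affine_root a 0 v"]
      c_nonneg that by simp
  \<comment> \<open>Every wall other than \<open>s\<close> is strictly positive at \<open>v\<close>,
    so its coefficient vanishes.\<close>
  have "\<exists>m\<ge>0. \<forall>v. f v = m * s v"
  proof (cases "s = affine_root (- \<theta>) 1")
    case True
    then have "c a = 0" if "a \<in> \<Delta>" for a
      using c_zero[OF that] v(2)[OF D(2)[OF that]] theta_root simple_root
      by (cases "affine_root a 0 = s") (auto simp: affine_root_inj)
    then show ?thesis
      using cd(2) True by (intro exI[of _ d]) (simp add: cd(3))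
  next
    case False
    then obtain b where b: "b \<in> \<Delta>" "s = affine_root b 0"
      using assms(1) by (auto simp: simple_affine_roots_def)
    have "d = 0"
      using zero(2) v(2)[OF D(1)] False by auto
    moreover have "c a = 0" if "a \<in> \<Delta> - {b}" for a
      using c_zero[of a] v(2)[OF D(2), of a] that b by (auto simp: affine_root_inj)
    then have "(\<Sum>a\<in>\<Delta>. c a * affine_root a 0 x) = c b * affine_root b 0 x" for x
      using b finite_simple by (subst sum.remove[of _ b]) auto
    ultimately show ?thesis
      using cd(1) b by (intro exI[of _ "c b"]) (simp add: cd(3))
  qed
  then show False
    using affine_root_multiple[OF assms(2)] assms(1,4) simple_affine_roots_subset by blast
qed

text \<open>If no simple reflection lowers the value at \<open>p\<close>, the gradient
  \<open>b\<close> has nonpositive inner product with all gradients of walls. As \<open>b\<close> is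
  a nonnegative combination of these, \<open>b \<bullet> b \<le> 0\<close>, which is absurd.\<close>

lemma affine_root_descent:
  assumes "f \<in> affine_roots \<Phi>" "0 < f p"
  shows "\<exists>s\<in>simple_affine_roots. f (root_reflection s p) < f p"
proof (rule ccontr)
  assume contra: "\<not> (\<exists>s\<in>simple_affine_roots. f (root_reflection s p) < f p)"
  obtain b k where bk: "f = affine_root b k" "b \<in> \<Phi>"
    using affine_rootE[OF assms(1)] by blast
  have le: "b \<bullet> grad s \<le> 0" if "s \<in> simple_affine_roots" for s
  proof -
    have "f p \<le> f (root_reflection s p)"
      using contra that by force
    then have "s p * (coroot (grad s) \<bullet> b) \<le> 0"
      unfolding bk(1) by (simp add: affine_root_def root_reflection_def inner_diff_left)
    moreover have "0 < s p"
      using that p_simple p_theta by (auto simp: simple_affine_roots_def affine_root_def)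
    ultimately have "coroot (grad s) \<bullet> b \<le> 0"
      by (simp add: mult_le_0_iff)
    moreover have "0 < grad s \<bullet> grad s"
      using that simple_affine_roots_subset root_neq_0 by (auto simp: affine_roots_def)
    ultimately show ?thesis
      by (auto simp: coroot_def inner_commute divide_le_0_iff mult_le_0_iff)
  qed
  obtain c d where cd: "\<And>a. 0 \<le> c a" "0 \<le> d" "grad f = (\<Sum>a\<in>\<Delta>. c a *\<^sub>R a) - d *\<^sub>R \<theta>"
    by (rule positive_affine_root_decomposition[OF assms]) (rule that)
  have "b \<bullet> b = (\<Sum>a\<in>\<Delta>. c a * (b \<bullet> a)) + d * (b \<bullet> - \<theta>)"
    using cd(3) unfolding bk(1) grad_affine_root
    by (metis (no_types, lifting) diff_conv_add_uminus inner_diff_right inner_minus_right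
        inner_scaleR_right inner_sum_right mult_minus_right sum.cong)
  also have "\<dots> \<le> 0"
  proof (rule add_nonpos_nonpos)
    show "(\<Sum>a\<in>\<Delta>. c a * (b \<bullet> a)) \<le> 0"
      using le[of "affine_root _ 0"] cd(1)
      by (intro sum_nonpos) (auto simp: simple_affine_roots_def mult_nonneg_nonpos)
    show "d * (b \<bullet> - \<theta>) \<le> 0"
      using le[of "affine_root (- \<theta>) 1"] cd(2)
      by (intro mult_nonneg_nonpos) (auto simp: simple_affine_roots_def)
  qed
  finally show False
    using root_neq_0[OF bk(2)] by (metis inner_gt_zero_iff not_less)
qed

lemma finite_affine_roots_below: "finite {f \<in> affine_roots \<Phi>. 0 < f p \<and> f p < M}"
proof (rule finite_subset)
  show "{f \<in> affine_roots \<Phi>. 0 < f p \<and> f p < M} \<subseteq>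
      (\<lambda>(a, k). affine_root a k) ` (\<Phi> \<times> {- 1..\<lceil>M\<rceil> + 1})"
  proof clarify
    fix f
    assume "f \<in> affine_roots \<Phi>" and f: "0 < f p" "f p < M"
    then obtain a k where ak: "f = affine_root a k" "a \<in> \<Phi>"
      by (elim affine_rootE)
    have "- 1 < real_of_int k" "real_of_int k < M + 1"
      using f inner_p_bounds[OF ak(2)] unfolding ak(1) affine_root_def by linarith+
    then have "k \<in> {- 1..\<lceil>M\<rceil> + 1}"
      by (simp, linarith)
    then show "f \<in> (\<lambda>(a, k). affine_root a k) ` (\<Phi> \<times> {- 1..\<lceil>M\<rceil> + 1})"
      using ak by auto
  qed
  show "finite ((\<lambda>(a, k). affine_root a k) ` (\<Phi> \<times> {- 1..\<lceil>M\<rceil> + 1}))"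
    using finite_roots by simp
qed

sublocale reflection_arrangement "affine_roots \<Phi>" root_reflection simple_affine_roots p
proof
  show comp: "f \<circ> root_reflection g \<in> affine_roots \<Phi>"
    if "f \<in> affine_roots \<Phi>" "g \<in> affine_roots \<Phi>" for f g
  proof -
    obtain a k b l where *: "f = affine_root a k" "a \<in> \<Phi>" "g = affine_root b l" "b \<in> \<Phi>"
      using \<open>f \<in> _\<close> \<open>g \<in> _\<close> by (elim affine_rootE)
    obtain n where n: "coroot b \<bullet> a = of_int n"
      using coroot_int[OF *(2,4)] by blast
    have "f \<circ> root_reflection g = affine_root (reflection b a) (k + (- l) * n)"
      using affine_root_comp_affine_reflection[OF n, of k "- l"] *
      by (simp add: root_reflection_affine_root)
    then show ?thesis
      using reflection_root * by (auto simp: affine_roots_def)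
  qed
  show "root_reflection f \<circ> root_reflection f = id" if "f \<in> affine_roots \<Phi>" for f
    using that
  proof (elim affine_rootE)
    fix a k
    assume "f = affine_root a k" "a \<in> \<Phi>"
    then show "root_reflection f \<circ> root_reflection f = id"
      by (simp only: root_reflection_affine_root affine_reflection_affine_reflection[OF root_neq_0])
  qed
  show "f (root_reflection f v) = - f v" if "f \<in> affine_roots \<Phi>" for f v
    using that root_neq_0
    by (elim affine_rootE) (auto simp: affine_root_def root_reflection_def inner_diff_left
        inner_commute[of "coroot _"] inner_coroot_self)
  show "root_reflection (f \<circ> root_reflection g) =
      root_reflection g \<circ> root_reflection f \<circ> root_reflection g"
    if "f \<in> affine_roots \<Phi>" "g \<in> affine_roots \<Phi>" for f g
  proof -
    obtain a k b l where *: "f = affine_root a k" "a \<in> \<Phi>" "g = affine_root b l" "b \<in> \<Phi>"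
      using \<open>f \<in> _\<close> \<open>g \<in> _\<close> by (elim affine_rootE)
    then show ?thesis
      using root_reflection_comp coroot_int root_neq_0 by metis
  qed
  show "f p \<noteq> 0" if "f \<in> affine_roots \<Phi>" for f
    using affine_root_p_nonzero[OF that] .
  show "simple_affine_roots \<subseteq> affine_roots \<Phi>"
    by (rule simple_affine_roots_subset)
  show "0 < s p" if "s \<in> simple_affine_roots" for s
    using that p_simple p_theta by (auto simp: simple_affine_roots_def affine_root_def)
  show "0 < f (root_reflection s p)"
    if "s \<in> simple_affine_roots" "f \<in> affine_roots \<Phi>" "0 < f p" "f \<noteq> s" for s f
    using root_reflection_simple_pos[OF that comp] that simple_affine_roots_subset by blast
  show "\<exists>s\<in>simple_affine_roots. f (root_reflection s p) < f p"
    if "f \<in> affine_roots \<Phi>" "0 < f p" "f \<notin> simple_affine_roots" for f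
    using affine_root_descent[OF that(1,2)] by blast
  show "finite {f \<in> affine_roots \<Phi>. 0 < f p \<and> f p < M}" for M
    by (rule finite_affine_roots_below)
qed

end

section \<open>The affine Weyl group as the group of the arrangement\<close>

context alcove
begin

text \<open>\<open>rf_in_G\<close> covers roots positive at \<open>p\<close>; of the two opposite
  roots of a hyperplane, one is positive there.\<close>

lemma affine_reflection_in_G:
  assumes "a \<in> \<Phi>"
  shows "affine_reflection a (of_int k) \<in> G"
proof -
  have "root_reflection (affine_root a (- k)) = affine_reflection a (of_int k)"
      "root_reflection (affine_root (- a) k) = affine_reflection a (of_int k)"
    by (simp_all add: root_reflection_affine_root affine_reflection_minus)
  moreover have "affine_root a (- k) \<in> affine_roots \<Phi>" "affine_root (- a) k \<in> affine_roots \<Phi>"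
    using assms uminus_root by (auto simp: affine_roots_def)
  moreover have "affine_root (- a) k p = - affine_root a (- k) p"
    by (simp add: affine_root_def)
  ultimately show ?thesis
    using rf_in_G root_nonzero by (metis linorder_neqE_linordered_idom neg_0_less_iff_less)
qed

text \<open>The product of the reflections in two parallel hyperplanes is a translation.\<close>

lemma translation_eq: "(+) (coroot a) = affine_reflection a 1 \<circ> reflection a" if "a \<in> \<Phi>"
proof
  fix v
  have "reflection a v \<bullet> a = - (v \<bullet> a)"
    using inner_coroot_self[OF root_neq_0[OF that]]
    by (simp add: reflection_def inner_diff_left inner_commute[of "coroot a"])
  then show "coroot a + v = (affine_reflection a 1 \<circ> reflection a) v"
    by (simp add: affine_reflection_def) (simp add: reflection_def algebra_simps)
qed

lemma transformation_group_G: "transformation_group G"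
  using id_in_G bij_G comp_in_G inv_in_G by (auto simp: transformation_group_def)

lemma transformation_group_weyl_group: "transformation_group (weyl_group \<Phi>)"
  unfolding weyl_group_def using bij_affine_reflection root_neq_0
  by (intro transformation_group_hull) (auto simp: reflection_eq_affine_reflection)

lemma transformation_group_affine_weyl_group: "transformation_group (affine_weyl_group \<Phi>)"
  unfolding affine_weyl_group_def using transformation_group_weyl_group
  by (intro transformation_group_hull) (auto simp: transformation_group_def)

lemma translation_in_G:
  assumes "x \<in> coroot_lattice \<Phi>"
  shows "(+) x \<in> G"
  using assms unfolding coroot_lattice_def
proof induction
  \<comment> \<open>The base case of the generated subgroup includes 0 besides the coroots.\<close>
  case (base s)
  have "(+) (coroot a) \<in> G" if "a \<in> \<Phi>" for a
    unfolding translation_eq[OF that] reflection_eq_affine_reflection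
    using comp_in_G affine_reflection_in_G[OF that, of 1] affine_reflection_in_G[OF that, of 0]
    by simp
  moreover have "(+) (0 :: 'a) = id"
    by auto
  ultimately show ?case
    using base id_in_G by (metis imageE insertE)
next
  case (diff s t)
  have "inv ((+) t) = (\<lambda>v. v - t)"
    by (rule inv_unique_comp) (auto simp: fun_eq_iff)
  then have "(+) (s - t) = (+) s \<circ> inv ((+) t)"
    by (auto simp: fun_eq_iff)
  then show ?case
    using diff comp_in_G inv_in_G by metis
qed

text \<open>Each group contains the generators of the other; \<open>s_0\<close> is the reflection in
  \<open>\<theta>\<close> followed by the translation by its coroot.\<close>

lemma G_eq: "G = affine_weyl_group \<Phi>"
proof
  have refl: "reflection a \<in> affine_weyl_group \<Phi>" if "a \<in> \<Phi>" for a
    using that unfolding affine_weyl_group_def weyl_group_def by (auto intro!: hull_inc)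
  have "(+) (coroot \<theta>) \<in> affine_weyl_group \<Phi>"
    using theta_root unfolding affine_weyl_group_def coroot_lattice_def
    by (auto intro!: hull_inc group_closure.base)
  then have "(+) (coroot \<theta>) \<circ> reflection \<theta> \<in> affine_weyl_group \<Phi>"
    using refl[OF theta_root] transformation_group_affine_weyl_group
    by (auto simp: transformation_group_def)
  moreover have "(+) (coroot \<theta>) \<circ> reflection \<theta> = affine_reflection \<theta> 1"
    by (auto simp: fun_eq_iff reflection_def affine_reflection_def algebra_simps)
  ultimately have gen: "affine_generators \<Delta> \<theta> \<subseteq> affine_weyl_group \<Phi>"
    using refl simple_root by (auto simp: affine_generators_def)
  have "set ss \<subseteq> affine_generators \<Delta> \<theta> \<Longrightarrow> word_prod ss \<in> affine_weyl_group \<Phi>" for ss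
    using transformation_group_affine_weyl_group gen
    by (induction ss) (auto simp: transformation_group_def)
  then show "G \<subseteq> affine_weyl_group \<Phi>"
    unfolding G_def root_reflection_simple_affine_roots by blast
  have "weyl_group \<Phi> \<subseteq> G"
    unfolding weyl_group_def
    by (rule hull_minimal) (use affine_reflection_in_G[of _ 0] transformation_group_G in
      \<open>auto simp: reflection_eq_affine_reflection\<close>)
  then show "affine_weyl_group \<Phi> \<subseteq> G"
    unfolding affine_weyl_group_def
    by (intro hull_minimal) (use translation_in_G transformation_group_G in auto)
qed

text \<open>The conjugate by \<open>\<sigma>\<close> of the reflection in \<open>s\<close> is the
  reflection in \<open>s \<circ> inv \<sigma>\<close>; if this root is negative at \<open>p\<close>,
  its opposite defines the same reflection.\<close>

lemma affine_reflectionsE: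
  assumes "r \<in> affine_reflections \<Phi> \<Delta> \<theta>"
  obtains a k where "a \<in> \<Phi>" "0 < affine_root a k p" "r = root_reflection (affine_root a k)"
proof -
  obtain \<sigma> s where \<sigma>: "\<sigma> \<in> G" "s \<in> simple_affine_roots" "r = \<sigma> \<circ> root_reflection s \<circ> inv \<sigma>"
    using assms unfolding affine_reflections_def G_eq root_reflection_simple_affine_roots[symmetric]
    by blast
  define f where "f = s \<circ> inv \<sigma>"
  have s: "s \<in> affine_roots \<Phi>"
    using \<sigma>(2) simple_affine_roots_subset by blast
  have f: "f \<in> affine_roots \<Phi>" "r = root_reflection f"
    using rf_comp_G[OF inv_in_G[OF \<sigma>(1)] s] inv_inv_eq[OF bij_G[OF \<sigma>(1)]] \<sigma>(3)
      root_comp_G[OF inv_in_G[OF \<sigma>(1)] s] by (simp_all add: f_def)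
  obtain a k where a: "f = affine_root a k" "a \<in> \<Phi>"
    using affine_rootE[OF f(1)] by blast
  show thesis
  proof (cases "0 < f p")
    case True
    then show ?thesis
      using that a f(2) by blast
  next
    case False
    then have "0 < affine_root (- a) (- k) p"
      using root_nonzero[OF f(1)] by (simp add: a affine_root_def)
    moreover have "r = root_reflection (affine_root (- a) (- k))"
      by (simp add: f(2) a root_reflection_affine_root affine_reflection_minus)
    ultimately show ?thesis
      using that uminus_root[OF a(2)] by blast
  qed
qed

section \<open>Linear parts and hyperplane counts\<close>

definition linear_part :: "('a \<Rightarrow> 'a) \<Rightarrow> 'a \<Rightarrow> 'a" where
  "linear_part w v = w v - w 0"

text \<open>Composing the root \<open>b\<close> with \<open>w\<close> gives an affine root again:
  its constant term is \<open>w 0 \<bullet> b\<close>, its gradient is the required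
  \<open>c\<close>.\<close>

lemma G_root_action:
  assumes "w \<in> G" "b \<in> \<Phi>"
  shows "w 0 \<bullet> b \<in> \<int>" "\<exists>c\<in>\<Phi>. \<forall>v. linear_part w v \<bullet> b = v \<bullet> c"
proof -
  have "affine_root b 0 \<circ> w \<in> affine_roots \<Phi>"
    by (rule root_comp_G[OF assms(1)]) (use assms(2) in \<open>auto simp: affine_roots_def\<close>)
  then obtain c m where c: "affine_root b 0 \<circ> w = affine_root c m" "c \<in> \<Phi>"
    by (rule affine_rootE)
  have "w v \<bullet> b = v \<bullet> c + of_int m" for v
    using fun_cong[OF c(1), of v] by (simp add: affine_root_def)
  then show "w 0 \<bullet> b \<in> \<int>" "\<exists>c\<in>\<Phi>. \<forall>v. linear_part w v \<bullet> b = v \<bullet> c"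
    using c(2) by (auto simp: linear_part_def inner_diff_left)
qed

lemma eq_if_inner_roots_eq:
  assumes "\<And>b. b \<in> \<Phi> \<Longrightarrow> x \<bullet> b = y \<bullet> b"
  shows "x = y"
proof -
  have "orthogonal (x - y) b" if "b \<in> \<Phi>" for b
    using assms[OF that] by (simp add: orthogonal_def inner_diff_left)
  then have "orthogonal (x - y) (x - y)"
    using span_roots orthogonal_to_span[of "x - y" \<Phi> "x - y"] by auto
  then show ?thesis
    by (simp add: orthogonal_def)
qed

text \<open>The roots span, so a linear part is determined by the map \<open>h\<close> from roots to
  roots describing its adjoint, and such maps are finite in number.\<close>

lemma finite_linear_parts: "finite (linear_part ` G)"
proof (rule finite_subset)
  let ?F = "\<lambda>h. THE g. \<forall>b\<in>\<Phi>. \<forall>v. g v \<bullet> b = v \<bullet> h b"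
  show "linear_part ` G \<subseteq> ?F ` (\<Phi> \<rightarrow>\<^sub>E \<Phi>)"
  proof clarify
    fix w
    assume w: "w \<in> G"
    obtain h where h: "\<And>b. b \<in> \<Phi> \<Longrightarrow> h b \<in> \<Phi> \<and> (\<forall>v. linear_part w v \<bullet> b = v \<bullet> h b)"
      using G_root_action(2)[OF w] by metis
    have eq: "?F (restrict h \<Phi>) = linear_part w"
    proof (rule the_equality)
      show "\<forall>b\<in>\<Phi>. \<forall>v. linear_part w v \<bullet> b = v \<bullet> restrict h \<Phi> b"
        using h by simp
      show "g = linear_part w" if "\<forall>b\<in>\<Phi>. \<forall>v. g v \<bullet> b = v \<bullet> restrict h \<Phi> b" for g
        using that h by (intro ext eq_if_inner_roots_eq) simp
    qed
    have "restrict h \<Phi> \<in> \<Phi> \<rightarrow>\<^sub>E \<Phi>"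
      using h by auto
    then show "linear_part w \<in> ?F ` (\<Phi> \<rightarrow>\<^sub>E \<Phi>)"
      by (rule rev_image_eqI) (simp only: eq)
  qed
  show "finite (?F ` (\<Phi> \<rightarrow>\<^sub>E \<Phi>))"
    using finite_roots by (intro finite_imageI finite_PiE)
qed

lemma linear_part_p_bounds:
  assumes "w \<in> G" "b \<in> \<Phi>"
  shows "linear_part w p \<bullet> b < 1" "- 1 < linear_part w p \<bullet> b" "linear_part w p \<bullet> b \<noteq> 0"
  using G_root_action(2)[OF assms] inner_p_bounds by auto

lemma apply_eq_linear_part: "w v = w 0 + linear_part w v"
  by (simp add: linear_part_def)

text \<open>\<open>sign_defect x b\<close> is the least integer \<open>k\<close> with \<open>0 < x \<bullet> b + k\<close>, if
  \<open>0 < \<bar>x \<bullet> b\<bar> < 1\<close>.\<close>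

definition sign_defect :: "'a \<Rightarrow> 'a \<Rightarrow> int" where
  "sign_defect x b = (if 0 < x \<bullet> b then 0 else 1)"

lemma affine_root_pos_iff:
  assumes "x \<bullet> b < 1" "- 1 < x \<bullet> b" "x \<bullet> b \<noteq> 0" "y \<bullet> b \<in> \<int>"
  shows "0 < affine_root b k (y + x) \<longleftrightarrow> sign_defect x b \<le> \<lfloor>y \<bullet> b\<rfloor> + k"
proof -
  obtain n where "y \<bullet> b = of_int n"
    using assms(4) by (elim Ints_cases)
  then show ?thesis
    using assms(1-3) unfolding affine_root_def sign_defect_def inner_add_left by simp linarith
qed

text \<open>The number of hyperplanes orthogonal to \<open>b\<close> that separate \<open>p\<close> from \<open>x + g p\<close>, with a
  negative sign if the step from \<open>p\<close> to \<open>x + g p\<close> crosses them in the direction of \<open>b\<close>.\<close>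

definition crossings :: "('a \<Rightarrow> 'a) \<Rightarrow> 'a \<Rightarrow> 'a \<Rightarrow> int" where
  "crossings g b x = sign_defect (g p) b - sign_defect p b - \<lfloor>x \<bullet> b\<rfloor>"

text \<open>The inversions with gradient \<open>b\<close> are indexed by an integer interval: the
  lower end says positive at \<open>p\<close>, the upper end says negative at \<open>w p\<close>.
  Its size is the number of crossings, which \<open>nat\<close> truncates to 0 if the interval is
  empty.\<close>

lemma card_inversions_G:
  assumes "w \<in> G"
  shows "card (inversions w) = (\<Sum>b\<in>\<Phi>. nat (crossings (linear_part w) b (w 0)))"
proof -
  let ?g = "linear_part w p"
  let ?K = "\<lambda>b. {sign_defect p b..<sign_defect ?g b - \<lfloor>w 0 \<bullet> b\<rfloor>}"
  have iff: "affine_root b k \<in> inversions w \<longleftrightarrow> k \<in> ?K b" if "b \<in> \<Phi>" for b k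
  proof -
    have "affine_root b k \<in> affine_roots \<Phi>"
      using that by (auto simp: affine_roots_def)
    moreover from this have "affine_root b k (w p) \<noteq> 0"
      using root_nonzero[OF root_comp_G[OF assms]] by fastforce
    moreover have "0 < affine_root b k (w p) \<longleftrightarrow> sign_defect ?g b \<le> \<lfloor>w 0 \<bullet> b\<rfloor> + k"
      unfolding apply_eq_linear_part[of w p]
      by (rule affine_root_pos_iff)
        (use linear_part_p_bounds[OF assms that] G_root_action(1)[OF assms that] in auto)
    moreover have "0 < affine_root b k p \<longleftrightarrow> sign_defect p b \<le> k"
      using affine_root_pos_iff[of p b 0 k] inner_p_bounds[OF that] by simp
    ultimately show ?thesis
      unfolding inversions_def by auto
  qed
  have "inversions w = (\<Union>b\<in>\<Phi>. affine_root b ` ?K b)"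
  proof (intro equalityI subsetI)
    fix f
    assume f: "f \<in> inversions w"
    then obtain b k where "f = affine_root b k" "b \<in> \<Phi>"
      unfolding inversions_def by (auto elim: affine_rootE)
    then show "f \<in> (\<Union>b\<in>\<Phi>. affine_root b ` ?K b)"
      using iff f by blast
  qed (use iff in blast)
  also have "card \<dots> = (\<Sum>b\<in>\<Phi>. card (affine_root b ` ?K b))"
    using finite_roots by (intro card_UN_disjoint) (auto simp: affine_root_inj)
  also have "\<dots> = (\<Sum>b\<in>\<Phi>. nat (crossings (linear_part w) b (w 0)))"
    by (intro sum.cong refl, subst card_image)
      (auto simp: inj_on_def affine_root_inj crossings_def algebra_simps)
  finally show ?thesis .
qed

section \<open>Translation parts with a fixed linear part\<close>

definition slice :: "('a \<Rightarrow> 'a) \<Rightarrow> 'a set" where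
  "slice g = {w 0 |w. w \<in> G \<and> linear_part w = g}"

lemma slice_ternary:
  assumes "x \<in> slice g" "y \<in> slice g" "z \<in> slice g"
  shows "x + y - z \<in> slice g"
proof -
  obtain u v w where u: "u \<in> G" "linear_part u = g" "x = u 0"
    and v: "v \<in> G" "linear_part v = g" "y = v 0"
    and w: "w \<in> G" "linear_part w = g" "z = w 0"
    using assms by (auto simp: slice_def)
  have "(u \<circ> inv w \<circ> v) t = x + y - z + g t" for t
  proof -
    have "w (inv w (v t)) = v t"
      using bij_G[OF w(1)] by (simp add: bij_is_surj surj_f_inv_f)
    then have "g (inv w (v t)) = y - z + g t"
      using apply_eq_linear_part[of w "inv w (v t)"] apply_eq_linear_part[of v t] v w
      by (simp add: algebra_simps)
    then show ?thesis
      using apply_eq_linear_part[of u "inv w (v t)"] u by (simp add: algebra_simps)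
  qed
  moreover have "g 0 = 0"
    using u(2) by (auto simp: linear_part_def)
  ultimately have "(u \<circ> inv w \<circ> v) 0 = x + y - z" "linear_part (u \<circ> inv w \<circ> v) = g"
    by (simp_all add: linear_part_def fun_eq_iff)
  moreover have "u \<circ> inv w \<circ> v \<in> G"
    using u v w comp_in_G inv_in_G by blast
  ultimately show ?thesis
    unfolding slice_def by (metis (mono_tags, lifting) mem_Collect_eq)
qed

lemma affine_on_floor_inner: "b \<in> \<Phi> \<Longrightarrow> affine_on (slice g) (\<lambda>x. \<lfloor>x \<bullet> b\<rfloor>)"
  unfolding affine_on_def
proof (intro ballI)
  fix x y z
  assume "b \<in> \<Phi>" "x \<in> slice g" "y \<in> slice g" "z \<in> slice g"
  then have "x \<bullet> b \<in> \<int>" "y \<bullet> b \<in> \<int>" "z \<bullet> b \<in> \<int>"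
    using G_root_action(1) by (auto simp: slice_def)
  then show "\<lfloor>(x + y - z) \<bullet> b\<rfloor> = \<lfloor>x \<bullet> b\<rfloor> + \<lfloor>y \<bullet> b\<rfloor> - \<lfloor>z \<bullet> b\<rfloor>"
    by (auto simp: inner_add_left inner_diff_left elim!: Ints_cases)
qed

lemma affine_on_crossings:
  assumes "b \<in> \<Phi>"
  shows "affine_on (slice g) (crossings g b)"
  using affine_on_floor_inner[OF assms, of g] by (simp add: affine_on_def crossings_def)

lemma bij_betw_slice: "bij_betw (\<lambda>w. w 0) {w \<in> G. linear_part w = g} (slice g)"
proof -
  have "inj_on (\<lambda>w. w 0) {w \<in> G. linear_part w = g}"
  proof (rule inj_onI)
    fix v w
    assume "v \<in> {w \<in> G. linear_part w = g}" "w \<in> {w \<in> G. linear_part w = g}" "v 0 = w 0"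
    then have "v 0 + linear_part v t = w 0 + linear_part w t" for t
      by simp
    then show "v = w"
      unfolding apply_eq_linear_part[symmetric] by auto
  qed
  then show ?thesis
    by (auto simp: bij_betw_def slice_def)
qed

text \<open>\<open>E\<close> records where \<open>crossings\<close> is nonnegative. Fixing it
  removes the truncations from the length formula, so the length becomes the affine function
  \<open>f\<close>.\<close>

lemma rational_length_series_sign_pattern:
  fixes a :: "'r \<Rightarrow> 'a" and k :: "'r \<Rightarrow> int" and g :: "'a \<Rightarrow> 'a"
  assumes "finite A" "\<And>r. r \<in> A \<Longrightarrow> a r \<in> \<Phi>" "E \<subseteq> \<Phi>"
  defines "S \<equiv> {w \<in> G. (\<forall>r\<in>A. 0 < affine_root (a r) (k r) (w p)) \<and> linear_part w = g \<and>
      {b \<in> \<Phi>. 0 \<le> crossings g b (w 0)} = E}"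
  shows "rational_fps (length_series (\<lambda>w. card (inversions w)) S)"
proof -
  \<comment> \<open>\<open>Inl\<close> constraints impose the sign pattern, the \<open>- 1\<close>
    expressing strict negativity of an integer; \<open>Inr\<close> constraints are the
    half-spaces.\<close>
  define c where "c i x = (case i of
      Inl b \<Rightarrow> if b \<in> E then crossings g b x else - crossings g b x - 1
    | Inr r \<Rightarrow> \<lfloor>x \<bullet> a r\<rfloor> + k r - sign_defect (g p) (a r))" for i x
  define f where "f x = (\<Sum>b\<in>E. crossings g b x)" for x
  let ?X = "polyhedron_points (slice g) (\<Phi> <+> A) c (\<lambda>_. 0)"
  have pos_iff: "0 < affine_root (a r) (k r) (w p) \<longleftrightarrow> 0 \<le> c (Inr r) (w 0)"
    if "w \<in> G" "linear_part w = g" "r \<in> A" for w r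
    unfolding apply_eq_linear_part[of w p] c_def
    using affine_root_pos_iff[of "linear_part w p" "a r" "w 0" "k r"]
      linear_part_p_bounds[OF that(1) assms(2)[OF that(3)]]
      G_root_action(1)[OF that(1) assms(2)[OF that(3)]] that(2) by auto
  have S_iff: "w \<in> S \<longleftrightarrow> w 0 \<in> ?X" if "w \<in> G" "linear_part w = g" for w
  proof -
    have "w 0 \<in> slice g"
      using that by (auto simp: slice_def)
    moreover have "{b \<in> \<Phi>. 0 \<le> crossings g b (w 0)} = E \<longleftrightarrow> (\<forall>b\<in>\<Phi>. 0 \<le> c (Inl b) (w 0))"
      using assms(3) by (auto simp: c_def split: if_splits)
    ultimately show ?thesis
      using that pos_iff[OF that] by (auto simp: S_def polyhedron_points_def)
  qed
  have "inj_on (\<lambda>w. w 0) {w \<in> G. linear_part w = g}"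
    using bij_betw_slice by (auto simp: bij_betw_def)
  then have "inj_on (\<lambda>w. w 0) S"
    by (rule inj_on_subset) (auto simp: S_def)
  moreover have X_eq: "?X = (\<lambda>w. w 0) ` S"
  proof (intro equalityI subsetI)
    fix x
    assume x: "x \<in> ?X"
    then obtain w where "w \<in> G" "linear_part w = g" "x = w 0"
      by (auto simp: polyhedron_points_def slice_def)
    then show "x \<in> (\<lambda>w. w 0) ` S"
      using S_iff x by blast
  qed (use S_iff in \<open>auto simp: S_def\<close>)
  ultimately have bij: "bij_betw (\<lambda>w. w 0) S ?X"
    by (simp add: bij_betw_def)
  have f: "0 \<le> f (w 0)" "nat (f (w 0)) = card (inversions w)" if "w \<in> S" for w
  proof -
    have w: "w \<in> G" "linear_part w = g" and E: "E = {b \<in> \<Phi>. 0 \<le> crossings g b (w 0)}"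
      using that by (auto simp: S_def)
    show "0 \<le> f (w 0)"
      unfolding f_def E by (rule sum_nonneg) simp
    have "card (inversions w) = (\<Sum>b\<in>\<Phi>. nat (crossings g b (w 0)))"
      using card_inversions_G[OF w(1)] w(2) by simp
    also have "\<dots> = (\<Sum>b\<in>E. nat (crossings g b (w 0)))"
      unfolding E by (rule sum.mono_neutral_right) (use finite_roots in auto)
    also have "int \<dots> = f (w 0)"
      unfolding f_def of_nat_sum by (rule sum.cong) (auto simp: E)
    finally show "nat (f (w 0)) = card (inversions w)"
      by simp
  qed
  have "length_series (\<lambda>w. card (inversions w)) S = length_series (\<lambda>x. nat (f x)) ?X"
    by (rule length_series_bij_betw[OF bij]) (rule f(2))
  also have "rational_fps \<dots>"
  proof (rule rational_length_series_polyhedron)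
    show "finite (\<Phi> <+> A)"
      using finite_roots assms(1) by simp
    show "x + y - z \<in> slice g" if "x \<in> slice g" "y \<in> slice g" "z \<in> slice g" for x y z
      using that by (rule slice_ternary)
    show "affine_on (slice g) (c i)" if "i \<in> \<Phi> <+> A" for i
      using that assms(2) affine_on_crossings[of _ g] affine_on_floor_inner[of _ g]
      by (auto simp: affine_on_def c_def)
    show "affine_on (slice g) f"
      using assms(3) affine_on_crossings[of _ g]
      by (auto simp: affine_on_def f_def sum.distrib[symmetric] sum_subtractf[symmetric]
          intro!: sum.cong)
    show "0 \<le> f x" if "x \<in> ?X" for x
      using that f(1) unfolding X_eq by blast
    \<comment> \<open>The fibres of \<open>f\<close> correspond to elements of a given word length
      over finitely many generators.\<close>
    show "finite {x \<in> ?X. nat (f x) = n}" for n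
    proof (rule finite_subset)
      show "{x \<in> ?X. nat (f x) = n} \<subseteq>
          (\<lambda>w. w 0) ` {w \<in> G. word_length (root_reflection ` simple_affine_roots) w = n}"
      proof clarify
        fix x
        assume "x \<in> ?X"
        then obtain w where w: "w \<in> S" "x = w 0"
          unfolding X_eq by blast
        then have "w \<in> G"
          by (simp add: S_def)
        then show "x \<in> (\<lambda>w. w 0) `
            {w \<in> G. word_length (root_reflection ` simple_affine_roots) w = nat (f x)}"
          using w f(2) by (auto simp: word_length_eq_card_inversions)
      qed
      show "finite ((\<lambda>w. w 0) ` {w \<in> G. word_length (root_reflection ` simple_affine_roots) w = n})"
        using finite_simple
        by (intro finite_imageI finite_word_length) (simp add: simple_affine_roots_def)
    qed
  qed
  finally show ?thesis .
qed

text \<open>The set is the disjoint union of its pieces over the finitely many pairs of a linear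
  part and a sign pattern.\<close>

lemma rational_length_series_halfspaces:
  fixes a :: "'r \<Rightarrow> 'a" and k :: "'r \<Rightarrow> int"
  assumes "finite A" "\<And>r. r \<in> A \<Longrightarrow> a r \<in> \<Phi>"
  shows "rational_fps (length_series (\<lambda>w. card (inversions w))
    {w \<in> G. \<forall>r\<in>A. 0 < affine_root (a r) (k r) (w p)})"
proof -
  define S where "S = (\<lambda>(g, E). {w \<in> G. (\<forall>r\<in>A. 0 < affine_root (a r) (k r) (w p)) \<and>
      linear_part w = g \<and> {b \<in> \<Phi>. 0 \<le> crossings g b (w 0)} = E})"
  let ?I = "linear_part ` G \<times> Pow \<Phi>" and ?len = "\<lambda>w. card (inversions w)"
  have eq: "{w \<in> G. \<forall>r\<in>A. 0 < affine_root (a r) (k r) (w p)} = (\<Union>i\<in>?I. S i)"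
    by (auto simp: S_def)
  have "length_series ?len (\<Union>i\<in>?I. S i) = (\<Sum>i\<in>?I. length_series ?len (S i))"
  proof (rule length_series_UN)
    show "finite ?I"
      using finite_linear_parts finite_roots by simp
    show "finite {w \<in> (\<Union>i\<in>?I. S i). ?len w = n}" for n
    proof (rule finite_subset)
      show "{w \<in> (\<Union>i\<in>?I. S i). ?len w = n} \<subseteq>
          {w \<in> G. word_length (root_reflection ` simple_affine_roots) w = n}"
        by (auto simp: S_def word_length_eq_card_inversions)
      show "finite {w \<in> G. word_length (root_reflection ` simple_affine_roots) w = n}"
        using finite_simple by (intro finite_word_length) (simp add: simple_affine_roots_def)
    qed
    show "S i \<inter> S j = {}" if "i \<noteq> j" for i j
      using that by (auto simp: S_def)
  qed
  also have "rational_fps \<dots>"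
    using rational_length_series_sign_pattern[OF assms]
    by (intro rational_fps_sum) (auto simp: S_def)
  finally show ?thesis
    unfolding eq .
qed

lemma rational_length_series_avoiding:
  assumes "finite A" "A \<subseteq> affine_reflections \<Phi> \<Delta> \<theta>"
  shows "rational_fps (length_series (affine_length \<Delta> \<theta>) (affine_weyl_avoiding \<Phi> \<Delta> \<theta> A))"
proof -
  have len: "affine_length \<Delta> \<theta> = word_length (root_reflection ` simple_affine_roots)"
    by (simp add: affine_length_def root_reflection_simple_affine_roots)
  have "\<forall>r\<in>A. \<exists>a k. a \<in> \<Phi> \<and> 0 < affine_root a k p \<and> r = root_reflection (affine_root a k)"
    using assms(2) affine_reflectionsE by (metis subsetD)
  then obtain a k where ak: "\<And>r. r \<in> A \<Longrightarrow> a r \<in> \<Phi>" "\<And>r. r \<in> A \<Longrightarrow> 0 < affine_root (a r) (k r) p"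
      "\<And>r. r \<in> A \<Longrightarrow> r = root_reflection (affine_root (a r) (k r))"
    by metis
  let ?X = "{w \<in> G. \<forall>r\<in>A. 0 < affine_root (a r) (k r) (w p)}"
  have less_iff: "affine_length \<Delta> \<theta> w < affine_length \<Delta> \<theta> (w \<circ> r) \<longleftrightarrow>
      0 < affine_root (a r) (k r) (inv w p)" if "w \<in> G" "r \<in> A" for w r
  proof -
    have root: "affine_root (a r) (k r) \<in> affine_roots \<Phi>"
      using ak(1)[OF that(2)] by (auto simp: affine_roots_def)
    show ?thesis
      using word_length_less_comp_rf_iff[OF that(1) root ak(2)[OF that(2)]] ak(3)[OF that(2)]
      unfolding len by simp
  qed
  have inv_inv: "inv (inv w) = w" if "w \<in> G" for w
    by (rule inv_inv_eq[OF bij_G[OF that]])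
  have avoiding: "affine_weyl_avoiding \<Phi> \<Delta> \<theta> A =
      {w \<in> G. \<forall>r\<in>A. 0 < affine_root (a r) (k r) (inv w p)}"
    unfolding affine_weyl_avoiding_def G_eq[symmetric] using less_iff by blast
  \<comment> \<open>Multiplication by \<open>r\<close> on the right is governed by
    \<open>inv w p\<close>, the half-space count by \<open>w p\<close>; inversion exchanges the two
    sets and preserves length.\<close>
  have "bij_betw inv ?X (affine_weyl_avoiding \<Phi> \<Delta> \<theta> A)"
    unfolding avoiding
    by (rule bij_betw_byWitness[where f' = inv]) (auto simp: inv_inv inv_in_G)
  then have "length_series (\<lambda>w. card (inversions w)) ?X =
      length_series (affine_length \<Delta> \<theta>) (affine_weyl_avoiding \<Phi> \<Delta> \<theta> A)"
    by (rule length_series_bij_betw) (simp add: len word_length_inv word_length_eq_card_inversions)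
  then show ?thesis
    using rational_length_series_halfspaces[OF assms(1), of a k] ak(1) by simp
qed

end

theorem theorem1:
  fixes \<Phi> \<Delta> :: "'a::euclidean_space set" and \<theta> :: 'a and A :: "('a \<Rightarrow> 'a) set"
  assumes "irreducible_root_system \<Phi>"
    and "simple_system \<Phi> \<Delta>"
    and "highest_root \<Phi> \<Delta> \<theta>"
    and "finite A"
    and "A \<subseteq> affine_reflections \<Phi> \<Delta> \<theta>"
  shows "rational_fps (length_series (affine_length \<Delta> \<theta>) (affine_weyl_avoiding \<Phi> \<Delta> \<theta> A))"
proof -
  interpret based_root_system \<Phi> \<Delta> \<theta>
    using assms by unfold_locales (auto simp: irreducible_root_system_def)
  obtain p where "\<And>a. a \<in> \<Delta> \<Longrightarrow> 0 < p \<bullet> a" "p \<bullet> \<theta> < 1"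
    by (rule alcove_point_exists) (rule that)
  then interpret alcove \<Phi> \<Delta> \<theta> p
    by unfold_locales
  show ?thesis
    using assms(4,5) by (rule rational_length_series_avoiding)
qed

end
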